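(* Suppose that the adversary's attack begins any finite lag $t_L$ after the start of detection. Then the Bellman deviation sequence has identical (unchanged) asymptotic limits: w.h.p. as $t_c(i,j)\to\infty$, for all $(i,j)\in\mathcal X\times\mathcal U$, $$\bar d_{i,j}\to\hat Q(i,j)-Q^*(i,j)+\gamma\,\mathbf p_{i,j}(\mathbf v-\hat{\mathbf v})^T$$ when secure, and $$\bar d_{i,j}\to\hat Q(i,j)-Q^*(i,j)+\gamma\,\mathbf p_{i,j}(\mathbf v-\hat{\mathbf v})^T+\tilde{\mathbf p}_{i,j}(\mathbf r_{i,j}+\gamma\mathbf v)^T$$ when under attack. Similarly, the information advantage condition remains unchanged as $$\Phi_{\min}>2(1+\gamma)\bar\epsilon.$$ Therefore, when the information advantage condition is met, the Bellman Deviation Detection algorithm guarantees attack detection while avoiding false alarms with high probability as $t_c\to\infty$, even for asynchronous attacks.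
   Context: Setting. A finite MDP $(\mathcal X,\mathcal U,\mathbf P,\mathbf R,\gamma)$ with $|\mathcal X|=N$, discount factor $\gamma\in[0,1)$; for each $(i,j)\in\mathcal X\times\mathcal U$, $\mathbf p_{i,j}$ is the row vector of transition probabilities and $\mathbf r_{i,j}$ the row vector of rewards $r_{i,j}(x')$ indexed by the next state $x'$. Observed rewards are $r_{i,j}(x')+w$ with $w$ i.i.d. zero-mean noise (finite variance is not assumed). $Q^*$ is the optimal Q-function, $V^*(x)=\max_uQ^*(x,u)$, $\mathbf v=[V^*(x_1),\dots,V^*(x_N)]$; Bellman equation: $Q^*(i,j)=\mathbf p_{i,j}(\mathbf r_{i,j}+\gamma\mathbf v)^T$. Agent. Before detection it has learned an estimate $\hat Q$ with $|\hat Q(x,u)-Q^*(x,u)|\le\epsilon(t_a)$ for all $(x,u)$ w.h.p. ($t_a$ is the training length, $\epsilon(t_a)\to0$ as $t_a\to\infty$); $\hat V(x)=\max_u\hat Q(x,u)$, $\hat{\mathbf v}=[\hat V(x_1),\dots,\hat V(x_N)]$; $\bar\epsilon\ge\epsilon(t_a)$ is an over-estimate of the agent's Q-function error. Adversary. It has a transition model $\hat{\mathbf P}$ with rows $\hat{\mathbf p}_{i,j}$; $\tilde{\mathbf p}_{i,j}=\mathbf p_{i,j}-\hat{\mathbf p}_{i,j}$. At times not under attack, the next state shown to the agent after $(i,j)$ is drawn from $\mathbf p_{i,j}$; at times under attack it is drawn from $\hat{\mathbf p}_{i,j}$. In both cases the agent receives the noisy reward for the transition shown. In the asynchronous attack,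 the first $t_L$ steps of the detection phase are not under attack and all later ones are; in the secure case there is never an attack. Minimum value drift: $\Phi_{\min}=\min_{(i,j)}|\tilde{\mathbf p}_{i,j}(\mathbf r_{i,j}+\gamma\mathbf v)^T|$. Bellman Deviation Detection algorithm. Input: the detection-phase trajectory of length $t_c$. Let $t_c(i,j)$ be the number of visits to $(i,j)$, and for the $k$-th visit let $x_{i,j}(k)$ be the next state and $w_{i,j}(k)$ the noise. Put $d_{i,j}(k)=\hat Q(i,j)-r_{i,j}(x_{i,j}(k))-w_{i,j}(k)-\gamma\hat V(x_{i,j}(k))$ (the Bellman deviation sequence) and $\bar d_{i,j}=\frac1{t_c(i,j)}\sum_{k=1}^{t_c(i,j)}d_{i,j}(k)$ (its mean). Discard pairs with $t_c(i,j)\le\frac{t_c}{2|\mathcal X||\mathcal U|}$; declare a breach iff the maximum of $|\bar d_{i,j}|$ over the remaining pairs exceeds $(1+\gamma)\bar\epsilon$. "Attack detection" means declaring a breach when under attack; a "false alarm" is a breach declared when secure. For an attack that begins simultaneously with detection, the "information advantage condition" is $\Phi_{\min}>2(1+\gamma)\bar\epsilon$, the condition under which this algorithm guarantees attack detection while avoiding false alarms w.h.p. as $t_c\to\infty$. An event occurs w.h.p. if its probability tends to $1$.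
   Formalization: For a fixed estimate the limit under attack has p̂ in place of p before (v−v̂), and the printed formula is proved only as training length grows; avoiding false alarms assumes ε(t_a)<ε̄ for fixed training, or ε̄>0 as training grows, since both claims fail otherwise. *)

theory Defs
  imports "HOL-Probability.Probability"
begin

definition trans_row :: "('x::finite \<Rightarrow> 'u \<Rightarrow> 'x pmf) \<Rightarrow> 'x \<Rightarrow> 'u \<Rightarrow> real ^ 'x" where
  "trans_row P i j = (\<chi> x'. pmf (P i j) x')"

text \<open>
  Distribution of the \<open>k\<close>-th state-action pair when the pair \<open>(i, j)\<close> comes first and all later
  actions are drawn from the stationary policy \<open>\<pi>\<close>.
\<close>

primrec sa_pmf :: "('x \<Rightarrow> 'u \<Rightarrow> 'x pmf) \<Rightarrow> ('x \<Rightarrow> 'u pmf) \<Rightarrow> nat \<Rightarrow> 'x \<Rightarrow> 'u \<Rightarrow> ('x \<times> 'u) pmf" where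
  "sa_pmf P \<pi> 0 i j = return_pmf (i, j)"
| "sa_pmf P \<pi> (Suc k) i j = bind_pmf (P i j) (\<lambda>x'. bind_pmf (\<pi> x') (\<lambda>u'. sa_pmf P \<pi> k x' u'))"

definition q_policy ::
  "('x::finite \<Rightarrow> 'u::finite \<Rightarrow> 'x pmf) \<Rightarrow> ('x \<Rightarrow> 'u \<Rightarrow> real ^ 'x) \<Rightarrow> real \<Rightarrow> ('x \<Rightarrow> 'u pmf) \<Rightarrow> 'x \<Rightarrow> 'u \<Rightarrow> real"
  where
  "q_policy P R \<gamma> \<pi> i j =
     (\<Sum>k. \<gamma> ^ k * measure_pmf.expectation (sa_pmf P \<pi> k i j) (\<lambda>(x, u). trans_row P x u \<bullet> R x u))"

definition q_opt ::
  "('x::finite \<Rightarrow> 'u::finite \<Rightarrow> 'x pmf) \<Rightarrow> ('x \<Rightarrow> 'u \<Rightarrow> real ^ 'x) \<Rightarrow> real \<Rightarrow> 'x \<Rightarrow> 'u \<Rightarrow> real"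
  where
  "q_opt P R \<gamma> i j = (SUP \<pi>. q_policy P R \<gamma> \<pi> i j)"

definition state_values :: "('x::finite \<Rightarrow> 'u::finite \<Rightarrow> real) \<Rightarrow> real ^ 'x" where
  "state_values Q = (\<chi> x. Max (range (Q x)))"

abbreviation v_opt ::
  "('x::finite \<Rightarrow> 'u::finite \<Rightarrow> 'x pmf) \<Rightarrow> ('x \<Rightarrow> 'u \<Rightarrow> real ^ 'x) \<Rightarrow> real \<Rightarrow> real ^ 'x" where
  "v_opt P R \<gamma> \<equiv> state_values (q_opt P R \<gamma>)"

text \<open>
  The supremum over stationary policies in \<open>q_opt\<close> is attained and solves the Bellman optimality
  equation, so admitting more general policies would not change its value.
\<close>

context
  fixes P :: "'x::finite \<Rightarrow> 'u::finite \<Rightarrow> 'x pmf" and R :: "'x \<Rightarrow> 'u \<Rightarrow> real ^ 'x" and \<gamma> :: real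
  assumes \<gamma>: "0 \<le> \<gamma>" "\<gamma> < 1"
begin

private abbreviation c :: "'x \<Rightarrow> 'u \<Rightarrow> real" where
  "c x u \<equiv> trans_row P x u \<bullet> R x u"

private abbreviation er :: "('x \<Rightarrow> 'u pmf) \<Rightarrow> nat \<Rightarrow> 'x \<Rightarrow> 'u \<Rightarrow> real" where
  "er \<pi> k i j \<equiv> measure_pmf.expectation (sa_pmf P \<pi> k i j) (\<lambda>(x, u). c x u)"

private abbreviation step :: "('x \<Rightarrow> 'u pmf) \<Rightarrow> ('x \<Rightarrow> 'u \<Rightarrow> real) \<Rightarrow> 'x \<Rightarrow> 'u \<Rightarrow> real" where
  "step \<pi> h i j \<equiv> (\<Sum>x\<in>UNIV. pmf (P i j) x * (\<Sum>u\<in>UNIV. pmf (\<pi> x) u * h x u))"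

private lemma pmf_avg_le:
  fixes p :: "'z::finite pmf" and f :: "'z \<Rightarrow> real"
  assumes "\<And>z. f z \<le> b" shows "(\<Sum>z\<in>UNIV. pmf p z * f z) \<le> b"
proof -
  have "(\<Sum>z\<in>UNIV. pmf p z * f z) \<le> (\<Sum>z\<in>UNIV. pmf p z * b)"
    by (intro sum_mono mult_left_mono assms) auto
  also have "\<dots> = b" by (simp add: sum_distrib_right[symmetric] sum_pmf_eq_1)
  finally show ?thesis .
qed

private lemma er_Suc: "er \<pi> (Suc k) i j = step \<pi> (er \<pi> k) i j"
  by (simp add: pmf_expectation_bind[where A = UNIV])

private lemma er_bounded: "\<exists>C. \<forall>\<pi> k i j. \<bar>er \<pi> k i j\<bar> \<le> C"
proof -
  define C where "C = Max (range (\<lambda>(x, u). \<bar>c x u\<bar>))"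
  have C: "\<bar>c x u\<bar> \<le> C" for x u
    unfolding C_def by (intro Max_ge) (auto intro: image_eqI[of _ _ "(x, u)"])
  have "\<bar>er \<pi> k i j\<bar> \<le> C" for \<pi> k i j
  proof (induction k arbitrary: i j)
    case 0 then show ?case using C by simp
  next
    case (Suc k)
    have "er \<pi> k x u \<le> C" "- er \<pi> k x u \<le> C" for x u
      using Suc.IH[of x u] by auto
    then have "step \<pi> (er \<pi> k) i j \<le> C" "step \<pi> (\<lambda>x u. - er \<pi> k x u) i j \<le> C"
      by - (rule pmf_avg_le, rule pmf_avg_le, assumption)+
    then show ?case unfolding er_Suc by (simp add: sum_negf)
  qed
  then show ?thesis by blast
qed

private lemma er_summable: "summable (\<lambda>k. \<gamma> ^ k * er \<pi> k i j)"
proof -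
  obtain C where C: "\<And>\<pi> k i j. \<bar>er \<pi> k i j\<bar> \<le> C" using er_bounded by blast
  have "summable (\<lambda>k. \<gamma> ^ k * C)" using \<gamma> by (intro summable_mult2 summable_geometric) auto
  moreover have "norm (\<gamma> ^ k * er \<pi> k i j) \<le> \<gamma> ^ k * C" for k
    using \<gamma> C by (auto simp: abs_mult intro: mult_left_mono)
  ultimately show ?thesis by (rule summable_comparison_test'[where N = 0])
qed

lemma q_policy_eq:
  "q_policy P R \<gamma> \<pi> i j = trans_row P i j \<bullet> R i j
     + \<gamma> * (\<Sum>x\<in>UNIV. pmf (P i j) x * (\<Sum>u\<in>UNIV. pmf (\<pi> x) u * q_policy P R \<gamma> \<pi> x u))"
proof -
  have sm: "(\<lambda>k. \<gamma> ^ k * er \<pi> k x u) sums q_policy P R \<gamma> \<pi> x u" for x u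
    unfolding q_policy_def using er_summable by (rule summable_sums)
  have "(\<lambda>k. \<gamma> * step \<pi> (\<lambda>x u. \<gamma> ^ k * er \<pi> k x u) i j) sums
      (\<gamma> * step \<pi> (q_policy P R \<gamma> \<pi>) i j)"
    by (intro sums_mult sums_sum sm)
  also have "(\<lambda>k. \<gamma> * step \<pi> (\<lambda>x u. \<gamma> ^ k * er \<pi> k x u) i j) = (\<lambda>k. \<gamma> ^ Suc k * er \<pi> (Suc k) i j)"
    unfolding er_Suc by (simp add: sum_distrib_left mult_ac)
  finally have "(\<lambda>k. \<gamma> ^ k * er \<pi> k i j) sums (\<gamma> * step \<pi> (q_policy P R \<gamma> \<pi>) i j + c i j)"
    by (subst (asm) sums_Suc_iff) simp
  from sums_unique2[OF sm this] show ?thesis by simp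
qed

private lemma q_policy_bounded: "\<exists>B. \<forall>\<pi>. q_policy P R \<gamma> \<pi> i j \<le> B"
proof -
  obtain C where C: "\<And>\<pi> k i j. \<bar>er \<pi> k i j\<bar> \<le> C" using er_bounded by blast
  have "q_policy P R \<gamma> \<pi> i j \<le> (\<Sum>k. \<gamma> ^ k * C)" for \<pi>
    unfolding q_policy_def using \<gamma> C
    by (intro suminf_le er_summable summable_mult2 summable_geometric mult_left_mono)
      (auto intro: order_trans[OF abs_ge_self])
  then show ?thesis by blast
qed

lemma q_policy_le_q_opt: "q_policy P R \<gamma> \<pi> i j \<le> q_opt P R \<gamma> i j"
  unfolding q_opt_def using q_policy_bounded[of i j]
  by (intro cSUP_upper) (auto simp: bdd_above_def)

private lemma step_nonpos:
  assumes "\<And>i j. h i j \<le> \<gamma> * step \<pi> h i j" shows "h i j \<le> 0"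
proof -
  define m where "m = Max (range (\<lambda>(x, u). h x u))"
  have le: "h x u \<le> m" for x u
    unfolding m_def by (intro Max_ge) (auto intro: image_eqI[of _ _ "(x, u)"])
  have "m \<in> range (\<lambda>(x, u). h x u)" unfolding m_def by (intro Max_in) auto
  then obtain i0 j0 where m: "m = h i0 j0" by auto
  have "step \<pi> h i0 j0 \<le> m" by (intro pmf_avg_le le)
  then have "m \<le> \<gamma> * m"
    using assms[of i0 j0] mult_left_mono[of "step \<pi> h i0 j0" m \<gamma>] \<gamma> unfolding m by linarith
  then have "(1 - \<gamma>) * m \<le> 0" by (simp add: algebra_simps)
  then have "m \<le> 0" using \<gamma> by (simp add: mult_le_0_iff)
  with le[of i j] show ?thesis by simp
qed

lemma bellman_equation:
  "q_opt P R \<gamma> i j = trans_row P i j \<bullet> (R i j + \<gamma> *\<^sub>R v_opt P R \<gamma>)"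
  and q_opt_attained: "\<exists>\<pi>. \<forall>x u. q_opt P R \<gamma> x u = q_policy P R \<gamma> \<pi> x u"
proof -
  define qs where "qs = q_opt P R \<gamma>"
  define V where "V x = Max (range (qs x))" for x
  have V: "qs x u \<le> V x" for x u unfolding V_def by (intro Max_ge) auto
  have "\<exists>u. qs x u = V x" for x
  proof -
    have "V x \<in> range (qs x)" unfolding V_def by (intro Max_in) auto
    then show ?thesis by auto
  qed
  then obtain g where g: "\<And>x. qs x (g x) = V x" by metis
  define \<pi> where "\<pi> x = return_pmf (g x)" for x
  have step_\<pi>: "step \<pi> h x u = (\<Sum>x'\<in>UNIV. pmf (P x u) x' * h x' (g x'))" for h x u
    by (simp add: \<pi>_def indicator_def if_distrib cong: if_cong)
  have upper: "qs x u \<le> c x u + \<gamma> * (\<Sum>x'\<in>UNIV. pmf (P x u) x' * V x')" for x u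
    unfolding qs_def q_opt_def
  proof (rule cSUP_least)
    fix \<pi>' :: "'x \<Rightarrow> 'u pmf"
    have "q_policy P R \<gamma> \<pi>' x' u' \<le> V x'" for x' u'
      using q_policy_le_q_opt[of \<pi>' x' u'] V[of x' u'] unfolding qs_def by simp
    then show "q_policy P R \<gamma> \<pi>' x u \<le> c x u + \<gamma> * (\<Sum>x'\<in>UNIV. pmf (P x u) x' * V x')"
      using \<gamma> by (subst q_policy_eq) (intro add_left_mono mult_left_mono sum_mono pmf_avg_le; simp)
  qed simp
  have "qs x u - q_policy P R \<gamma> \<pi> x u \<le> 0" for x u
  proof (rule step_nonpos[of "\<lambda>x u. qs x u - q_policy P R \<gamma> \<pi> x u" \<pi>])
    fix x u
    have "q_policy P R \<gamma> \<pi> x u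
        = c x u + \<gamma> * (\<Sum>x'\<in>UNIV. pmf (P x u) x' * q_policy P R \<gamma> \<pi> x' (g x'))"
      by (subst q_policy_eq) (simp only: step_\<pi>)
    then show "qs x u - q_policy P R \<gamma> \<pi> x u
        \<le> \<gamma> * step \<pi> (\<lambda>x u. qs x u - q_policy P R \<gamma> \<pi> x u) x u"
      using upper[of x u] by (simp only: step_\<pi> g) (simp add: algebra_simps sum_subtractf)
  qed
  then have eq: "qs x u = q_policy P R \<gamma> \<pi> x u" for x u
    using q_policy_le_q_opt[of \<pi> x u] unfolding qs_def by (simp add: order_antisym)
  then show "\<exists>\<pi>. \<forall>x u. q_opt P R \<gamma> x u = q_policy P R \<gamma> \<pi> x u" unfolding qs_def by blast
  have "qs i j = c i j + \<gamma> * (\<Sum>x'\<in>UNIV. pmf (P i j) x' * V x')"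
    using q_policy_eq[of \<pi> i j] by (simp only: step_\<pi> eq[symmetric] g)
  then show "q_opt P R \<gamma> i j = trans_row P i j \<bullet> (R i j + \<gamma> *\<^sub>R v_opt P R \<gamma>)"
    by (simp add: inner_add_right qs_def V_def state_values_def)
      (simp add: trans_row_def inner_vec_def)
qed

end

text \<open>The transition kernel from which the state shown after step \<open>n\<close> is drawn.\<close>

definition secure :: "('x \<Rightarrow> 'u \<Rightarrow> 'x pmf) \<Rightarrow> nat \<Rightarrow> 'x \<Rightarrow> 'u \<Rightarrow> 'x pmf" where
  "secure P n = P"

definition attack_after ::
  "nat \<Rightarrow> ('x \<Rightarrow> 'u \<Rightarrow> 'x pmf) \<Rightarrow> ('x \<Rightarrow> 'u \<Rightarrow> 'x pmf) \<Rightarrow> nat \<Rightarrow> 'x \<Rightarrow> 'u \<Rightarrow> 'x pmf" where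
  "attack_after tL P Phat n = (if n < tL then P else Phat)"

definition value_drift ::
  "('x::finite \<Rightarrow> 'u::finite \<Rightarrow> 'x pmf) \<Rightarrow> ('x \<Rightarrow> 'u \<Rightarrow> 'x pmf) \<Rightarrow> ('x \<Rightarrow> 'u \<Rightarrow> real ^ 'x) \<Rightarrow> real \<Rightarrow>
    'x \<Rightarrow> 'u \<Rightarrow> real" where
  "value_drift P Phat R \<gamma> i j =
     (trans_row P i j - trans_row Phat i j) \<bullet> (R i j + \<gamma> *\<^sub>R v_opt P R \<gamma>)"

definition min_value_drift ::
  "('x::finite \<Rightarrow> 'u::finite \<Rightarrow> 'x pmf) \<Rightarrow> ('x \<Rightarrow> 'u \<Rightarrow> 'x pmf) \<Rightarrow> ('x \<Rightarrow> 'u \<Rightarrow> real ^ 'x) \<Rightarrow> real \<Rightarrow> real"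
  where
  "min_value_drift P Phat R \<gamma> = Min (range (\<lambda>(i, j). \<bar>value_drift P Phat R \<gamma> i j\<bar>))"

text \<open>
  A trajectory is given by the states \<open>x n\<close> shown to the agent, its actions \<open>u n\<close> and the reward
  noise \<open>w n\<close>: step \<open>n\<close> shows the transition from \<open>x n\<close> to \<open>x (Suc n)\<close>.  The list below contains
  the visits to \<open>(i, j)\<close> among the first \<open>t\<close> steps in increasing order.
\<close>

definition visits :: "(nat \<Rightarrow> 'x) \<Rightarrow> (nat \<Rightarrow> 'u) \<Rightarrow> nat \<Rightarrow> 'x \<Rightarrow> 'u \<Rightarrow> nat list" where
  "visits x u t i j = filter (\<lambda>n. x n = i \<and> u n = j) [0..<t]"

definition deviations ::
  "('x::finite \<Rightarrow> 'u::finite \<Rightarrow> real ^ 'x) \<Rightarrow> real \<Rightarrow> ('x \<Rightarrow> 'u \<Rightarrow> real) \<Rightarrow>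
    (nat \<Rightarrow> 'x) \<Rightarrow> (nat \<Rightarrow> 'u) \<Rightarrow> (nat \<Rightarrow> real) \<Rightarrow> nat \<Rightarrow> 'x \<Rightarrow> 'u \<Rightarrow> real list" where
  "deviations R \<gamma> Q x u w t i j =
     map (\<lambda>n. Q i j - R i j $ x (Suc n) - w n - \<gamma> * state_values Q $ x (Suc n)) (visits x u t i j)"

definition mean_deviation ::
  "('x::finite \<Rightarrow> 'u::finite \<Rightarrow> real ^ 'x) \<Rightarrow> real \<Rightarrow> ('x \<Rightarrow> 'u \<Rightarrow> real) \<Rightarrow>
    (nat \<Rightarrow> 'x) \<Rightarrow> (nat \<Rightarrow> 'u) \<Rightarrow> (nat \<Rightarrow> real) \<Rightarrow> nat \<Rightarrow> 'x \<Rightarrow> 'u \<Rightarrow> real" where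
  "mean_deviation R \<gamma> Q x u w t i j =
     sum_list (deviations R \<gamma> Q x u w t i j) / real (length (visits x u t i j))"

text \<open>
  The maximum ranges over the pairs that are not discarded.  For \<open>t > 0\<close> there is at least one such
  pair, by the pigeonhole principle.
\<close>

definition breach_declared ::
  "('x::finite \<Rightarrow> 'u::finite \<Rightarrow> real ^ 'x) \<Rightarrow> real \<Rightarrow> real \<Rightarrow> ('x \<Rightarrow> 'u \<Rightarrow> real) \<Rightarrow>
    (nat \<Rightarrow> 'x) \<Rightarrow> (nat \<Rightarrow> 'u) \<Rightarrow> (nat \<Rightarrow> real) \<Rightarrow> nat \<Rightarrow> bool" where
  "breach_declared R \<gamma> ebar Q x u w t \<longleftrightarrow>
     Max {\<bar>mean_deviation R \<gamma> Q x u w t i j\<bar> | i j.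
            real (length (visits x u t i j)) > real t / (2 * real CARD('x) * real CARD('u))}
       > (1 + \<gamma>) * ebar"

text \<open>
  From the \<open>k\<close>-th visit to a pair onwards, its mean deviation stays within \<open>\<delta>\<close> of \<open>L\<close>.  Convergence
  of the mean deviations to \<open>L\<close> w.h.p. as the numbers of visits tend to infinity says that, for
  every \<open>\<delta> > 0\<close>, the probability of this event tends to 1 as \<open>k\<close> tends to infinity.
\<close>

definition deviations_near ::
  "('x::finite \<Rightarrow> 'u::finite \<Rightarrow> real ^ 'x) \<Rightarrow> real \<Rightarrow> ('x \<Rightarrow> 'u \<Rightarrow> real) \<Rightarrow>
    (nat \<Rightarrow> 'x) \<Rightarrow> (nat \<Rightarrow> 'u) \<Rightarrow> (nat \<Rightarrow> real) \<Rightarrow> ('x \<Rightarrow> 'u \<Rightarrow> real) \<Rightarrow> real \<Rightarrow> nat \<Rightarrow> bool" where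
  "deviations_near R \<gamma> Q x u w L \<delta> k \<longleftrightarrow>
     (\<forall>i j t. length (visits x u t i j) \<ge> k \<longrightarrow> \<bar>mean_deviation R \<gamma> Q x u w t i j - L i j\<bar> \<le> \<delta>)"

definition limit_secure ::
  "('x::finite \<Rightarrow> 'u::finite \<Rightarrow> 'x pmf) \<Rightarrow> ('x \<Rightarrow> 'u \<Rightarrow> real ^ 'x) \<Rightarrow> real \<Rightarrow> ('x \<Rightarrow> 'u \<Rightarrow> real) \<Rightarrow>
    'x \<Rightarrow> 'u \<Rightarrow> real" where
  "limit_secure P R \<gamma> Q i j =
     Q i j - q_opt P R \<gamma> i j + \<gamma> * (trans_row P i j \<bullet> (v_opt P R \<gamma> - state_values Q))"

text \<open>
  Under attack the mean deviation tends to \<open>Q i j - trans_row Phat i j \<bullet> (R i j + \<gamma> *\<^sub>R state_values Q)\<close>.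
  The Bellman equation rewrites this as \<open>limit_attack\<close>, where the error of the value estimate is
  weighted by the row of \<open>Phat\<close>.  The variant \<open>limit_attack_approx\<close> weights it by the row of \<open>P\<close>;
  for a fixed estimate it may be off by up to \<open>2 * \<gamma>\<close> times the largest error of \<open>Q\<close>, so it is
  the limit only as that error vanishes.
\<close>

definition limit_attack ::
  "('x::finite \<Rightarrow> 'u::finite \<Rightarrow> 'x pmf) \<Rightarrow> ('x \<Rightarrow> 'u \<Rightarrow> 'x pmf) \<Rightarrow> ('x \<Rightarrow> 'u \<Rightarrow> real ^ 'x) \<Rightarrow> real \<Rightarrow>
    ('x \<Rightarrow> 'u \<Rightarrow> real) \<Rightarrow> 'x \<Rightarrow> 'u \<Rightarrow> real" where
  "limit_attack P Phat R \<gamma> Q i j =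
     Q i j - q_opt P R \<gamma> i j + \<gamma> * (trans_row Phat i j \<bullet> (v_opt P R \<gamma> - state_values Q))
       + value_drift P Phat R \<gamma> i j"

definition limit_attack_approx ::
  "('x::finite \<Rightarrow> 'u::finite \<Rightarrow> 'x pmf) \<Rightarrow> ('x \<Rightarrow> 'u \<Rightarrow> 'x pmf) \<Rightarrow> ('x \<Rightarrow> 'u \<Rightarrow> real ^ 'x) \<Rightarrow> real \<Rightarrow>
    ('x \<Rightarrow> 'u \<Rightarrow> real) \<Rightarrow> 'x \<Rightarrow> 'u \<Rightarrow> real" where
  "limit_attack_approx P Phat R \<gamma> Q i j = limit_secure P R \<gamma> Q i j + value_drift P Phat R \<gamma> i j"

text \<open>
  \<open>F n\<close> is the information available once the action of step \<open>n\<close> has been chosen; the history of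
  training is part of \<open>F 0\<close>.  The policy of the agent is arbitrary (it may depend on the past and
  be randomised).  \<open>K n\<close> is the kernel from which the state shown after step \<open>n\<close> is drawn.  As the
  noise of earlier steps is measurable with respect to \<open>F n\<close>, the last five assumptions make the
  noise i.i.d. with mean zero; the noise of a step may still depend on the state shown after it.
\<close>

locale detection_phase = prob_space M + filtration "space M" F
  for M :: "'w measure" and F :: "nat \<Rightarrow> 'w measure" +
  fixes K :: "nat \<Rightarrow> 'x::finite \<Rightarrow> 'u::finite \<Rightarrow> 'x pmf"
    and Q :: "'w \<Rightarrow> 'x \<Rightarrow> 'u \<Rightarrow> real"
    and X :: "'w \<Rightarrow> nat \<Rightarrow> 'x" and U :: "'w \<Rightarrow> nat \<Rightarrow> 'u" and W :: "'w \<Rightarrow> nat \<Rightarrow> real"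
  assumes sets_F_M: "sets (F n) \<subseteq> sets M"
    and Q_measurable: "(\<lambda>\<omega>. Q \<omega> x u) \<in> borel_measurable (F 0)"
    and X_measurable: "(\<lambda>\<omega>. X \<omega> n) \<in> measurable (F n) (count_space UNIV)"
    and U_measurable: "(\<lambda>\<omega>. U \<omega> n) \<in> measurable (F n) (count_space UNIV)"
    and next_state: "A \<in> sets (F n) \<Longrightarrow>
      prob {\<omega> \<in> A. X \<omega> n = i \<and> U \<omega> n = j \<and> X \<omega> (Suc n) = x'} =
        pmf (K n i j) x' * prob {\<omega> \<in> A. X \<omega> n = i \<and> U \<omega> n = j}"
    and W_measurable: "(\<lambda>\<omega>. W \<omega> n) \<in> borel_measurable (F (Suc n))"
    and W_indep: "indep_set (sets (F n)) (sets (vimage_algebra (space M) (\<lambda>\<omega>. W \<omega> n) borel))"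
    and W_distr: "distr M borel (\<lambda>\<omega>. W \<omega> n) = distr M borel (\<lambda>\<omega>. W \<omega> 0)"
    and W_integrable: "integrable M (\<lambda>\<omega>. W \<omega> 0)"
    and W_mean: "expectation (\<lambda>\<omega>. W \<omega> 0) = 0"

definition accurate ::
  "('x::finite \<Rightarrow> 'u::finite \<Rightarrow> 'x pmf) \<Rightarrow> ('x \<Rightarrow> 'u \<Rightarrow> real ^ 'x) \<Rightarrow> real \<Rightarrow> real \<Rightarrow>
    ('x \<Rightarrow> 'u \<Rightarrow> real) \<Rightarrow> bool" where
  "accurate P R \<gamma> e Q \<longleftrightarrow> (\<forall>x u. \<bar>Q x u - q_opt P R \<gamma> x u\<bar> \<le> e)"

text \<open>
  Two asymptotic regimes are involved: the accuracy of the estimate is only guaranteed w.h.p. as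
  the training length \<open>ta\<close> grows, and the detection phase grows after training has ended.
\<close>

definition whp_after_training :: "(nat \<Rightarrow> nat \<Rightarrow> real) \<Rightarrow> bool" where
  "whp_after_training p \<longleftrightarrow>
     (\<forall>\<eta>>0. \<forall>\<^sub>F ta in sequentially. \<forall>\<^sub>F n in sequentially. p ta n \<ge> 1 - \<eta>)"

end

theory Submission
  imports Defs
begin

text \<open>
  The Bellman equation shows that both limits have the form
  \<open>Q i j - trans_row P' i j \<bullet> (R i j + \<gamma> *\<^sub>R state_values Q)\<close>, where \<open>P'\<close> is the kernel that is
  eventually in force, so a finite lag cannot matter.  Since the policy is arbitrary, the visits to
  a pair occur at random times, and convergence there is a strong law for adaptively sampled
  variables: the visit indicator and the visit count are known before the next state and the noise
  are drawn, so the centred terms, divided by the visit count, are martingale differences.  Noise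
  without a second moment is first truncated at the visit count, which makes the sum of their
  variances finite; by Kolmogorov's maximal inequality their sum converges almost surely, and
  Kronecker's lemma turns this into convergence of averages.  For an accurate estimate the secure
  limits are at most \<open>(1 + \<gamma>) * e\<close> in absolute value, and the limits under attack exceed
  \<open>(1 + \<gamma>) * ebar\<close> by a fixed margin.
\<close>

subsection \<open>Weighted averages\<close>

text \<open>Two features rule out a direct appeal to the classical strong law: a pair is visited at
  times chosen by the policy, and the noise of a step may depend on the state shown after it. The
  deviation is therefore split. Its reward and value part is a finite combination of transition
  frequencies, and the noise is averaged separately, so that their joint law does not enter. Random
  visit times are harmless because the visit count runs through 1, 2, 3, ... without repetition: on
  every path, a sum over the visits of a nonnegative function of the count is at most its sum over
  the positive integers. Hence the truncation level is the same count that serves as divisor; a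
  level tied to elapsed time could be far above the count of a rarely visited pair and leave the
  variances uncontrolled. A limit is off by at most \<open>e\<close> through \<open>Q\<close> and
  \<open>\<gamma> * e\<close> through the value estimate, which explains the threshold factor
  \<open>1 + \<gamma>\<close>; the factor 2 in the information advantage condition pays once for
  this error and once for the threshold.\<close>

lemma weighted_average_tendsto:
  fixes w y :: "nat \<Rightarrow> real"
  assumes w: "\<And>n. w n \<ge> 0"
    and W: "filterlim (\<lambda>n. \<Sum>m<n. w m) at_top sequentially"
    and y: "y \<longlonglongrightarrow> l"
  shows "(\<lambda>n. (\<Sum>m<n. w m * y m) / (\<Sum>m<n. w m)) \<longlonglongrightarrow> l"
proof (rule LIMSEQ_I)
  fix r :: real assume r: "r > 0"
  obtain M where M: "\<And>m. m \<ge> M \<Longrightarrow> \<bar>y m - l\<bar> < r / 2"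
    using LIMSEQ_D[OF y, of "r / 2"] r by auto
  \<comment> \<open>The finitely many terms before \<open>M\<close> cost a fixed amount, which the
    divergent total weight outgrows.\<close>
  define C where "C = (\<Sum>m<M. w m * \<bar>y m - l\<bar>)"
  have C: "C \<ge> 0" unfolding C_def using w by (intro sum_nonneg) auto
  have "\<forall>\<^sub>F n in sequentially. (\<Sum>m<n. w m) > 2 * C / r"
    using W by (auto simp: filterlim_at_top_dense)
  then obtain N where N: "\<And>n. n \<ge> N \<Longrightarrow> (\<Sum>m<n. w m) > 2 * C / r"
    by (auto simp: eventually_sequentially)
  have "norm ((\<Sum>m<n. w m * y m) / (\<Sum>m<n. w m) - l) < r" if n: "n \<ge> max M N" for n
  proof -
    let ?B = "\<Sum>m<n. w m"
    have B: "?B > 2 * C / r" using N n by auto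
    have B0: "?B > 0" using B C r by (meson divide_nonneg_pos mult_nonneg_nonneg order_le_less_trans zero_le_numeral)
    have split: "{..<n} = {..<M} \<union> {M..<n}" using n by auto
    have "\<bar>\<Sum>m<n. w m * (y m - l)\<bar> \<le> (\<Sum>m<n. w m * \<bar>y m - l\<bar>)"
      by (rule order_trans[OF sum_abs]) (simp add: abs_mult w)
    also have "\<dots> = C + (\<Sum>m\<in>{M..<n}. w m * \<bar>y m - l\<bar>)"
      unfolding C_def split by (rule sum.union_disjoint) auto
    also have "(\<Sum>m\<in>{M..<n}. w m * \<bar>y m - l\<bar>) \<le> (\<Sum>m\<in>{M..<n}. w m * (r / 2))"
      by (intro sum_mono mult_left_mono w less_imp_le[OF M]) auto
    also have "\<dots> \<le> (\<Sum>m<n. w m * (r / 2))"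
      unfolding split using w r by (intro sum_mono2) auto
    also have "\<dots> = ?B * (r / 2)" by (simp only: sum_distrib_right)
    finally have "\<bar>\<Sum>m<n. w m * (y m - l)\<bar> \<le> C + ?B * (r / 2)" by simp
    also have "C < ?B * (r / 2)" using B r by (simp add: field_simps)
    finally have *: "\<bar>\<Sum>m<n. w m * (y m - l)\<bar> < ?B * r" by (simp add: mult.commute)
    have "(\<Sum>m<n. w m * y m) / ?B - l = (\<Sum>m<n. w m * (y m - l)) / ?B"
      using B0 by (simp add: right_diff_distrib sum_subtractf sum_distrib_right[symmetric] diff_divide_distrib)
    then show ?thesis using * B0 by (simp add: pos_divide_less_eq mult.commute)
  qed
  then show "\<exists>N. \<forall>n\<ge>N. norm ((\<Sum>m<n. w m * y m) / (\<Sum>m<n. w m) - l) < r" by blast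
qed

text \<open>Abel summation turns the numerator into \<open>b n * s (Suc n)\<close> minus a sum of
  partial sums weighted by the increments of \<open>b\<close>; after division both parts tend to the
  limit of the series. The numerator runs up to \<open>n\<close> inclusive because the divisor will
  be a count that includes step \<open>n\<close>.\<close>

lemma kronecker:
  fixes b x :: "nat \<Rightarrow> real"
  assumes mono: "\<And>n. b n \<le> b (Suc n)" and b: "filterlim b at_top sequentially"
    and x: "convergent (\<lambda>n. \<Sum>m<n. x m)"
  shows "(\<lambda>n. (\<Sum>m<Suc n. b m * x m) / b n) \<longlonglongrightarrow> 0"
proof -
  define s where "s n = (\<Sum>m<n. x m)" for n
  obtain l where s: "s \<longlonglongrightarrow> l" using x unfolding s_def convergent_def by blast
  define w where "w n = b (Suc n) - b n" for n
  have w_sum: "(\<Sum>m<n. w m) = b n - b 0" for n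
    unfolding w_def by (rule sum_lessThan_telescope)
  have "filterlim (\<lambda>n. - b 0 + b n) at_top sequentially"
    by (rule filterlim_tendsto_add_at_top[OF tendsto_const b])
  then have lim: "filterlim (\<lambda>n. \<Sum>m<n. w m) at_top sequentially"
    unfolding w_sum by (simp add: add.commute)
  have avg: "(\<lambda>n. (\<Sum>m<n. w m * s (Suc m)) / (b n - b 0)) \<longlonglongrightarrow> l"
    using weighted_average_tendsto[OF _ lim, of "\<lambda>m. s (Suc m)" l] LIMSEQ_Suc[OF s] mono
    unfolding w_sum by (simp add: w_def)
  have b0: "(\<lambda>n. b 0 / b n) \<longlonglongrightarrow> 0"
    by (rule real_tendsto_divide_at_top[OF tendsto_const b])
  have pos: "\<forall>\<^sub>F n in sequentially. b n > max 0 (b 0)"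
    using b by (auto simp: filterlim_at_top_dense simp del: max_less_iff_conj)
  have abel: "(\<Sum>m<n. b m * x m) = b n * s n - b 0 * s 0 - (\<Sum>m<n. w m * s (Suc m))" for n
    by (induction n) (simp_all add: w_def s_def algebra_simps)
  have "(\<lambda>n. s (Suc n) - ((\<Sum>m<n. w m * s (Suc m)) / (b n - b 0)) * (1 - b 0 / b n)) \<longlonglongrightarrow> l - l * (1 - 0)"
    by (intro tendsto_intros avg b0 LIMSEQ_Suc s)
  moreover have "\<forall>\<^sub>F n in sequentially.
      s (Suc n) - ((\<Sum>m<n. w m * s (Suc m)) / (b n - b 0)) * (1 - b 0 / b n)
      = (\<Sum>m<Suc n. b m * x m) / b n"
    using pos
  proof eventually_elim
    case (elim n)
    have "(\<Sum>m<Suc n. b m * x m) = b n * s (Suc n) - (\<Sum>m<n. w m * s (Suc m))"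
      using abel[of n] by (simp add: s_def algebra_simps)
    moreover have "((\<Sum>m<n. w m * s (Suc m)) / (b n - b 0)) * (1 - b 0 / b n) = (\<Sum>m<n. w m * s (Suc m)) / b n"
      using elim by (simp add: field_simps)
    ultimately show ?case using elim by (simp add: diff_divide_distrib)
  qed
  ultimately show ?thesis by (auto dest: Lim_transform_eventually)
qed

subsection \<open>Bounded martingale difference sequences\<close>

locale adapted_space = prob_space M + filtration "space M" F
  for M :: "'w measure" and F :: "nat \<Rightarrow> 'w measure" +
  assumes sets_F: "sets (F n) \<subseteq> sets M"
begin

lemma subalgebra_F: "subalgebra M (F n)"
  unfolding subalgebra_def using space_F sets_F by auto

lemma measurable_F: "f \<in> measurable (F n) N \<Longrightarrow> f \<in> measurable M N"
  by (rule measurable_from_subalg[OF subalgebra_F])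

lemma measurable_F_mono: "f \<in> measurable (F m) N \<Longrightarrow> m \<le> n \<Longrightarrow> f \<in> measurable (F n) N"
  by (rule measurable_from_subalg[of _ "F m"]) (simp_all add: subalgebra_def space_F sets_F_mono)

text \<open>The martingale property is phrased by integrals over past events instead of conditional
  expectations, since this is the form in which \<open>next_state\<close> delivers it. One bound for
  all steps settles every question of integrability.\<close>

definition bounded_mds :: "(nat \<Rightarrow> 'w \<Rightarrow> real) \<Rightarrow> bool" where
  "bounded_mds D \<longleftrightarrow> (\<exists>C. \<forall>n \<omega>. \<bar>D n \<omega>\<bar> \<le> C) \<and> (\<forall>n. D n \<in> borel_measurable (F (Suc n))) \<and>
     (\<forall>n. \<forall>A\<in>sets (F n). (\<integral>\<omega>. indicator A \<omega> * D n \<omega> \<partial>M) = 0)"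

lemma integrable_bounded:
  assumes "f \<in> borel_measurable M" "\<And>\<omega>. \<bar>f \<omega>\<bar> \<le> (C::real)"
  shows "integrable M f"
  using assms by (intro integrable_const_bound[where B = C]) auto

lemma bounded_mds_integrable: "bounded_mds D \<Longrightarrow> integrable M (D n)"
proof -
  assume D: "bounded_mds D"
  then obtain C where "\<And>\<omega>. \<bar>D n \<omega>\<bar> \<le> C" unfolding bounded_mds_def by blast
  with D show ?thesis
    unfolding bounded_mds_def by (intro integrable_bounded[OF measurable_F[of _ "Suc n"]]) auto
qed

text \<open>Vanishing integrals over past events say that the conditional expectation is zero, and a
  predictable factor can be moved out of it.\<close>

lemma integral_predictable_mult:
  fixes D g :: "'w \<Rightarrow> real"
  assumes D: "integrable M D" "\<And>A. A \<in> sets (F n) \<Longrightarrow> (\<integral>\<omega>. indicator A \<omega> * D \<omega> \<partial>M) = 0"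
    and g: "g \<in> borel_measurable (F n)" "integrable M (\<lambda>\<omega>. g \<omega> * D \<omega>)"
  shows "(\<integral>\<omega>. g \<omega> * D \<omega> \<partial>M) = 0"
proof -
  interpret finite_measure_subalgebra M "F n" by unfold_locales (rule subalgebra_F)
  have "AE \<omega> in M. real_cond_exp M (F n) D \<omega> = 0"
    using D by (intro real_cond_exp_charact) (simp_all add: set_lebesgue_integral_def)
  moreover have "(\<integral>\<omega>. g \<omega> * D \<omega> \<partial>M) = (\<integral>\<omega>. g \<omega> * real_cond_exp M (F n) D \<omega> \<partial>M)"
    using real_cond_exp_intg(2)[OF g(2,1)] D(1) by simp
  ultimately show ?thesis
    by (auto intro!: integral_eq_zero_AE)
qed

text \<open>A martingale transform. It later serves to stop the sums, to restart them at a given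
  index and to divide by the visit count.\<close>

lemma bounded_mds_mult:
  assumes D: "bounded_mds D" and g: "\<And>n. g n \<in> borel_measurable (F n)" "\<And>n \<omega>. \<bar>g n \<omega>\<bar> \<le> 1"
  shows "bounded_mds (\<lambda>n \<omega>. g n \<omega> * D n \<omega>)"
proof -
  obtain C where C: "\<And>n \<omega>. \<bar>D n \<omega>\<bar> \<le> C" using D unfolding bounded_mds_def by blast
  have Dm: "D n \<in> borel_measurable (F (Suc n))" for n using D unfolding bounded_mds_def by blast
  have gC: "\<bar>g n \<omega> * D n \<omega>\<bar> \<le> C" for n \<omega>
    using mult_mono[OF g(2)[of n \<omega>] C[of n \<omega>]] by (simp add: abs_mult)
  have gm: "(\<lambda>\<omega>. g n \<omega> * D n \<omega>) \<in> borel_measurable (F (Suc n))" for n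
    using measurable_F_mono[OF g(1)[of n], of "Suc n"] Dm[of n] by simp
  have "(\<integral>\<omega>. indicator A \<omega> * (g n \<omega> * D n \<omega>) \<partial>M) = 0" if A: "A \<in> sets (F n)" for A n
  proof -
    have "(\<lambda>\<omega>. indicator A \<omega> * g n \<omega>) \<in> borel_measurable (F n)"
      using A g(1)[of n] by simp
    moreover have "integrable M (\<lambda>\<omega>. indicator A \<omega> * (g n \<omega> * D n \<omega>))"
      using integrable_real_mult_indicator[OF subsetD[OF sets_F A] integrable_bounded[OF measurable_F[OF gm[of n]] gC]]
      by (simp add: mult.commute)
    ultimately show ?thesis
      using integral_predictable_mult[OF bounded_mds_integrable[OF D, of n], of n "\<lambda>\<omega>. indicator A \<omega> * g n \<omega>"] D
      unfolding bounded_mds_def by (simp add: mult.assoc)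
  qed
  with gC gm show ?thesis unfolding bounded_mds_def by blast
qed

lemma partial_sum_measurable:
  assumes "\<And>n. D n \<in> borel_measurable (F (Suc n))" "n \<le> k"
  shows "(\<lambda>\<omega>. (\<Sum>m<n. D m \<omega> :: real)) \<in> borel_measurable (F k)"
  using assms by (intro borel_measurable_sum measurable_F_mono[OF assms(1)]) auto

text \<open>Martingale differences are orthogonal: the earlier sum is known at time
  \<open>n\<close>, so its product with the next term has mean zero.\<close>

lemma bounded_mds_sum_square:
  assumes D: "bounded_mds D"
  shows "(\<integral>\<omega>. (\<Sum>m<n. D m \<omega>)\<^sup>2 \<partial>M) = (\<Sum>m<n. \<integral>\<omega>. (D m \<omega>)\<^sup>2 \<partial>M)"
proof (induction n)
  case (Suc n)
  obtain C where C: "\<And>n \<omega>. \<bar>D n \<omega>\<bar> \<le> C" using D unfolding bounded_mds_def by blast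
  have Dm: "D n \<in> borel_measurable (F (Suc n))" for n using D unfolding bounded_mds_def by blast
  have DM[measurable]: "D n \<in> borel_measurable M" for n by (rule measurable_F[OF Dm])
  define S where "S \<omega> = (\<Sum>m<n. D m \<omega>)" for \<omega>
  have S_F: "S \<in> borel_measurable (F n)"
    unfolding S_def by (rule partial_sum_measurable[OF Dm order_refl])
  then have [measurable]: "S \<in> borel_measurable M" by (rule measurable_F)
  have S_le: "\<bar>S \<omega>\<bar> \<le> real n * C" for \<omega>
    unfolding S_def using order_trans[OF sum_abs sum_bounded_above[of "{..<n}" "\<lambda>m. \<bar>D m \<omega>\<bar>" C]] C by simp
  have C0: "C \<ge> 0" using C[of 0 undefined] by linarith
  have bounds: "\<bar>(S \<omega>)\<^sup>2\<bar> \<le> (real n * C)\<^sup>2" "\<bar>(D n \<omega>)\<^sup>2\<bar> \<le> C\<^sup>2"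
    "\<bar>S \<omega> * D n \<omega>\<bar> \<le> (real n * C) * C" for \<omega>
    using power_mono[OF S_le abs_ge_zero, of \<omega> 2] power_mono[OF C abs_ge_zero, of n \<omega> 2]
      mult_mono[OF S_le C[of n \<omega>], of \<omega>] C0 by (simp_all add: abs_mult)
  have int: "integrable M (\<lambda>\<omega>. (S \<omega>)\<^sup>2)" "integrable M (\<lambda>\<omega>. (D n \<omega>)\<^sup>2)" "integrable M (\<lambda>\<omega>. S \<omega> * D n \<omega>)"
    by (rule integrable_bounded[OF _ bounds(1)], measurable)
      (rule integrable_bounded[OF _ bounds(2)], measurable, rule integrable_bounded[OF _ bounds(3)], measurable)
  have "(\<integral>\<omega>. S \<omega> * D n \<omega> \<partial>M) = 0"
    using integral_predictable_mult[OF bounded_mds_integrable[OF D, of n] _ S_F int(3)] D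
    unfolding bounded_mds_def by blast
  moreover have "(\<Sum>m<Suc n. D m \<omega>)\<^sup>2 = (S \<omega>)\<^sup>2 + (D n \<omega>)\<^sup>2 + 2 * (S \<omega> * D n \<omega>)" for \<omega>
    unfolding S_def by (simp add: power2_sum)
  ultimately show ?case using int Suc.IH[folded S_def] by simp
qed simp

text \<open>The stopped sums are again sums of martingale differences, so orthogonality controls
  their second moment and Markov's inequality for the square gives the bound.\<close>

lemma kolmogorov_maximal:
  assumes D: "bounded_mds D" and \<epsilon>: "\<epsilon> > 0"
  shows "prob {\<omega> \<in> space M. \<exists>n\<le>N. \<epsilon> \<le> \<bar>\<Sum>m<n. D m \<omega>\<bar>} \<le> (\<Sum>m<N. \<integral>\<omega>. (D m \<omega>)\<^sup>2 \<partial>M) / \<epsilon>\<^sup>2"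
proof -
  have Dm: "D n \<in> borel_measurable (F (Suc n))" for n using D unfolding bounded_mds_def by blast
  have DM[measurable]: "D n \<in> borel_measurable M" for n by (rule measurable_F[OF Dm])
  obtain C where C: "\<And>n \<omega>. \<bar>D n \<omega>\<bar> \<le> C" using D unfolding bounded_mds_def by blast
  define S where "S n \<omega> = (\<Sum>m<n. D m \<omega>)" for n \<omega>
  \<comment> \<open>Stopping the sums when they first reach \<open>\<epsilon>\<close> turns the maximum into the final value.\<close>
  define g where "g n \<omega> = (if \<forall>l\<in>{..n}. \<bar>S l \<omega>\<bar> < \<epsilon> then 1 else 0 :: real)" for n \<omega>
  have g_F: "g n \<in> borel_measurable (F n)" for n
  proof -
    have [measurable]: "S l \<in> borel_measurable (F n)" if "l \<in> {..n}" for l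
      using that unfolding S_def by (intro partial_sum_measurable[OF Dm]) auto
    show ?thesis unfolding g_def by measurable
  qed
  note gM[measurable] = measurable_F[OF g_F]
  define E where "E n \<omega> = g n \<omega> * D n \<omega>" for n \<omega>
  have E: "bounded_mds E"
    unfolding E_def by (rule bounded_mds_mult[OF D g_F]) (simp add: g_def)
  have E_M[measurable]: "E n \<in> borel_measurable M" for n unfolding E_def by measurable
  have E_le: "(E n \<omega>)\<^sup>2 \<le> (D n \<omega>)\<^sup>2" for n \<omega> unfolding E_def g_def by simp
  have D2: "(D n \<omega>)\<^sup>2 \<le> C\<^sup>2" for n \<omega> using power_mono[OF C abs_ge_zero, of n \<omega> 2] by simp
  have int_D: "integrable M (\<lambda>\<omega>. (D n \<omega>)\<^sup>2)" for n
    using D2 by (intro integrable_bounded[where C = "C\<^sup>2"]) auto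
  have int_E: "integrable M (\<lambda>\<omega>. (E n \<omega>)\<^sup>2)" for n
    using order_trans[OF E_le D2] by (intro integrable_bounded[where C = "C\<^sup>2"]) auto
  have stopped: "\<epsilon> \<le> \<bar>\<Sum>m<N. E m \<omega>\<bar>" if "\<exists>n\<le>N. \<epsilon> \<le> \<bar>S n \<omega>\<bar>" for \<omega>
  proof -
    define n where "n = (LEAST n. \<epsilon> \<le> \<bar>S n \<omega>\<bar>)"
    have n: "\<epsilon> \<le> \<bar>S n \<omega>\<bar>" unfolding n_def using that by (auto intro: LeastI)
    have nN: "n \<le> N" unfolding n_def using that by (meson Least_le order_trans)
    have less: "\<bar>S l \<omega>\<bar> < \<epsilon>" if "l < n" for l
      using not_less_Least[of l "\<lambda>n. \<epsilon> \<le> \<bar>S n \<omega>\<bar>"] that unfolding n_def by linarith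
    \<comment> \<open>\<open>S n\<close> has no term of index \<open>n\<close>, so stopping on the
      basis of \<open>S n\<close> keeps exactly the terms of the sum at first passage and drops the
      next one.\<close>
    have E1: "E m \<omega> = D m \<omega>" if "m < n" for m
      using less that unfolding E_def g_def by auto
    have E0: "E m \<omega> = 0" if "m \<ge> n" for m
    proof -
      have "\<not> (\<forall>l\<in>{..m}. \<bar>S l \<omega>\<bar> < \<epsilon>)" using n that by (meson atMost_iff not_less)
      then have "g m \<omega> = 0" unfolding g_def by (rule if_not_P)
      then show ?thesis unfolding E_def by simp
    qed
    have "(\<Sum>m<N. E m \<omega>) = (\<Sum>m<n. E m \<omega>)"
      using nN E0 by (intro sum.mono_neutral_right) auto
    also have "\<dots> = S n \<omega>" unfolding S_def using E1 by (intro sum.cong) auto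
    finally show ?thesis using n by simp
  qed
  obtain B where B: "\<And>\<omega>. \<bar>(\<Sum>m<N. E m \<omega>)\<^sup>2\<bar> \<le> B"
  proof
    fix \<omega>
    have "\<bar>E m \<omega>\<bar> \<le> C" for m using order_trans[OF _ C[of m \<omega>]] E_le[of m \<omega>] by (simp add: abs_le_square_iff)
    then have "\<bar>\<Sum>m<N. E m \<omega>\<bar> \<le> real N * C"
      using order_trans[OF sum_abs sum_bounded_above[of "{..<N}" "\<lambda>m. \<bar>E m \<omega>\<bar>" C]] by simp
    from power_mono[OF this abs_ge_zero, of 2] show "\<bar>(\<Sum>m<N. E m \<omega>)\<^sup>2\<bar> \<le> (real N * C)\<^sup>2" by simp
  qed
  have "prob {\<omega> \<in> space M. \<exists>n\<le>N. \<epsilon> \<le> \<bar>S n \<omega>\<bar>} \<le> prob {\<omega> \<in> space M. \<epsilon>\<^sup>2 \<le> (\<Sum>m<N. E m \<omega>)\<^sup>2}"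
    using stopped \<epsilon> by (intro finite_measure_mono) (auto simp: abs_le_square_iff[symmetric])
  also have "\<dots> \<le> (\<integral>\<omega>. (\<Sum>m<N. E m \<omega>)\<^sup>2 \<partial>M) / \<epsilon>\<^sup>2"
    using \<epsilon> B by (intro integral_Markov_inequality_measure[where A = "{}"] integrable_bounded[where C = B]) auto
  also have "\<dots> \<le> (\<Sum>m<N. \<integral>\<omega>. (D m \<omega>)\<^sup>2 \<partial>M) / \<epsilon>\<^sup>2"
    unfolding bounded_mds_sum_square[OF E]
    using E_le int_D int_E by (intro divide_right_mono sum_mono integral_mono) auto
  finally show ?thesis unfolding S_def .
qed

text \<open>The maximal inequality bounds the oscillation after index \<open>k\<close> by a tail of
  the variance series, which vanishes as \<open>k\<close> grows; so almost every path is
  Cauchy.\<close>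

lemma bounded_mds_convergent:
  assumes D: "bounded_mds D" and sm: "summable (\<lambda>n. \<integral>\<omega>. (D n \<omega>)\<^sup>2 \<partial>M)"
  shows "AE \<omega> in M. convergent (\<lambda>n. \<Sum>m<n. D m \<omega>)"
proof -
  have Dm: "D n \<in> borel_measurable (F (Suc n))" for n using D unfolding bounded_mds_def by blast
  have DM[measurable]: "D n \<in> borel_measurable M" for n by (rule measurable_F[OF Dm])
  define v where "v n = (\<integral>\<omega>. (D n \<omega>)\<^sup>2 \<partial>M)" for n
  define S where "S n \<omega> = (\<Sum>m<n. D m \<omega>)" for n \<omega>
  have [measurable]: "S n \<in> borel_measurable M" for n unfolding S_def by measurable
  have v: "v n \<ge> 0" for n unfolding v_def by simp
  have tail: "prob {\<omega> \<in> space M. \<exists>n. \<epsilon> \<le> \<bar>S (k + n) \<omega> - S k \<omega>\<bar>} \<le> (\<Sum>n. v (n + k)) / \<epsilon>\<^sup>2"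
    if \<epsilon>: "\<epsilon> > 0" for \<epsilon> k
  proof -
    \<comment> \<open>Zeroing the first \<open>k\<close> terms restarts the sums at
      \<open>k\<close>.\<close>
    define E where "E n \<omega> = (if k \<le> n then 1 else 0) * D n \<omega>" for n \<omega>
    have E: "bounded_mds E" unfolding E_def by (rule bounded_mds_mult[OF D]) auto
    have sumE: "(\<Sum>m<k + n. E m \<omega>) = S (k + n) \<omega> - S k \<omega>" for n \<omega>
      by (induction n) (auto simp: E_def S_def)
    have vE: "(\<Sum>m<k + n. \<integral>\<omega>. (E m \<omega>)\<^sup>2 \<partial>M) = (\<Sum>m<n. v (m + k))" for n
    proof (induction n)
      case 0 show ?case by (simp add: E_def)
    next
      case (Suc n) then show ?case by (simp add: E_def v_def add.commute)
    qed
    define A where "A N = {\<omega> \<in> space M. \<exists>n\<le>N. \<epsilon> \<le> \<bar>S (k + n) \<omega> - S k \<omega>\<bar>}" for N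
    have [measurable]: "A N \<in> sets M" for N unfolding A_def by measurable
    have "prob (A N) \<le> (\<Sum>n. v (n + k)) / \<epsilon>\<^sup>2" for N
    proof -
      have "prob (A N) \<le> prob {\<omega> \<in> space M. \<exists>n\<le>k + N. \<epsilon> \<le> \<bar>\<Sum>m<n. E m \<omega>\<bar>}"
      proof (rule finite_measure_mono)
        show "A N \<subseteq> {\<omega> \<in> space M. \<exists>n\<le>k + N. \<epsilon> \<le> \<bar>\<Sum>m<n. E m \<omega>\<bar>}"
          unfolding A_def sumE[symmetric] by (blast intro: add_left_mono)
        show "{\<omega> \<in> space M. \<exists>n\<le>k + N. \<epsilon> \<le> \<bar>\<Sum>m<n. E m \<omega>\<bar>} \<in> sets M"
          unfolding E_def by measurable
      qed
      also have "\<dots> \<le> (\<Sum>m<k + N. \<integral>\<omega>. (E m \<omega>)\<^sup>2 \<partial>M) / \<epsilon>\<^sup>2"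
        by (rule kolmogorov_maximal[OF E \<epsilon>])
      also have "\<dots> \<le> (\<Sum>n. v (n + k)) / \<epsilon>\<^sup>2"
        unfolding vE using v sm[folded v_def]
        by (intro divide_right_mono sum_le_suminf) (auto simp: summable_iff_shift)
      finally show ?thesis .
    qed
    \<comment> \<open>Continuity from below removes the finite horizon of the maximal
      inequality.\<close>
    moreover have "(\<lambda>N. prob (A N)) \<longlonglongrightarrow> prob (\<Union>N. A N)"
    proof (intro finite_Lim_measure_incseq)
      show "incseq A" unfolding incseq_def A_def by (blast intro: le_trans)
    qed auto
    moreover have "(\<Union>N. A N) = {\<omega> \<in> space M. \<exists>n. \<epsilon> \<le> \<bar>S (k + n) \<omega> - S k \<omega>\<bar>}"
      unfolding A_def by auto
    ultimately show ?thesis by (auto intro: LIMSEQ_le_const2)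
  qed
  have lim: "(\<lambda>k. (\<Sum>n. v (n + k)) / \<epsilon>\<^sup>2) \<longlonglongrightarrow> 0" for \<epsilon> :: real
    using suminf_exist_split2[OF sm] unfolding v_def by (auto intro: tendsto_divide_zero)
  have osc: "AE \<omega> in M. \<exists>k. \<forall>n. \<bar>S (k + n) \<omega> - S k \<omega>\<bar> < \<epsilon>" if \<epsilon>: "\<epsilon> > 0" for \<epsilon>
  proof -
    \<comment> \<open>A path in \<open>Z\<close> oscillates after every index, so
      \<open>prob Z\<close> lies below every tail bound.\<close>
    define Z where "Z = {\<omega> \<in> space M. \<forall>k. \<exists>n. \<epsilon> \<le> \<bar>S (k + n) \<omega> - S k \<omega>\<bar>}"
    have [measurable]: "Z \<in> sets M" unfolding Z_def by measurable
    have "prob Z \<le> (\<Sum>n. v (n + k)) / \<epsilon>\<^sup>2" for k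
      by (rule order_trans[OF finite_measure_mono tail[OF \<epsilon>]]) (auto simp: Z_def)
    then have "prob Z \<le> 0" by (intro LIMSEQ_le_const[OF lim[of \<epsilon>]]) auto
    then have "prob Z = 0" using measure_nonneg[of M Z] by linarith
    then have "Z \<in> null_sets M" by (simp add: null_sets_def emeasure_eq_measure)
    then have "AE \<omega> in M. \<omega> \<notin> Z" by (rule AE_not_in)
    then show ?thesis using AE_space
    proof eventually_elim
      case (elim \<omega>)
      then show ?case unfolding Z_def by (auto simp: not_le)
    qed
  qed
  have "AE \<omega> in M. \<forall>j. \<exists>k. \<forall>n. \<bar>S (k + n) \<omega> - S k \<omega>\<bar> < inverse (real (Suc j))"
    unfolding AE_all_countable by (auto intro: osc)
  then show ?thesis
  proof eventually_elim
    case (elim \<omega>)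
    have "Cauchy (\<lambda>n. S n \<omega>)"
    proof (rule metric_CauchyI)
      fix e :: real assume "e > 0"
      then obtain j where j: "inverse (real (Suc j)) < e / 2" using reals_Archimedean[of "e / 2"] by auto
      obtain k where k: "\<And>n. \<bar>S (k + n) \<omega> - S k \<omega>\<bar> < inverse (real (Suc j))" using elim by blast
      have "dist (S m \<omega>) (S n \<omega>) < e" if "m \<ge> k" "n \<ge> k" for m n
        using k[of "m - k"] k[of "n - k"] that j by (auto simp: dist_real_def)
      then show "\<exists>M. \<forall>m\<ge>M. \<forall>n\<ge>M. dist (S m \<omega>) (S n \<omega>) < e" by blast
    qed
    then show ?case unfolding S_def by (rule Cauchy_convergent)
  qed
qed

end

subsection \<open>Averages over random times of occurrence\<close>

text \<open>Only steps before \<open>n\<close> are counted, so the count that includes step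
  \<open>n\<close> has index \<open>Suc n\<close>; that one becomes divisor and truncation
  level.\<close>

definition occurrences :: "(nat \<Rightarrow> bool) \<Rightarrow> nat \<Rightarrow> nat" where
  "occurrences p n = card {m. m < n \<and> p m}"

lemma occurrences_0 [simp]: "occurrences p 0 = 0"
  by (simp add: occurrences_def)

lemma occurrences_Suc: "occurrences p (Suc n) = occurrences p n + of_bool (p n)"
proof -
  have "{m. m < Suc n \<and> p m} = (if p n then insert n {m. m < n \<and> p m} else {m. m < n \<and> p m})"
    by (auto simp: less_Suc_eq)
  then show ?thesis by (simp add: occurrences_def)
qed

lemma occurrences_eq_sum: "real (occurrences p n) = (\<Sum>m<n. of_bool (p m))"
  by (induction n) (auto simp: occurrences_Suc)

lemma mono_occurrences: "mono (occurrences p)"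
  by (auto simp: occurrences_Suc mono_iff_le_Suc)

lemma occurrences_le: "occurrences p n \<le> n"
  by (induction n) (auto simp: occurrences_Suc)

text \<open>The count increases by one exactly at the occurrences, so along them it takes the values
  1, 2, 3, ... once each.\<close>

lemma sum_over_occurrences:
  "(\<Sum>n<N. of_bool (p n) * h (occurrences p (Suc n))) = (\<Sum>k<occurrences p N. h (Suc k) :: ennreal)"
  by (induction N) (auto simp: occurrences_Suc)

text \<open>Only an inequality: if \<open>p\<close> holds finitely often, the large counts are never
  reached.\<close>

lemma suminf_over_occurrences_le:
  fixes h :: "nat \<Rightarrow> ennreal"
  shows "(\<Sum>n. of_bool (p n) * h (occurrences p (Suc n))) \<le> (\<Sum>k. h (Suc k))"
  by (rule suminf_le_const) (auto simp: sum_over_occurrences intro!: sum_le_suminf)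

lemma average_at_occurrences_tendsto:
  fixes y :: "nat \<Rightarrow> real"
  assumes "filterlim (occurrences p) at_top sequentially" "y \<longlonglongrightarrow> l"
  shows "(\<lambda>n. (\<Sum>m<n. of_bool (p m) * y m) / real (occurrences p n)) \<longlonglongrightarrow> l"
  using assms weighted_average_tendsto[of "\<lambda>m. of_bool (p m)" y l]
    filterlim_compose[OF filterlim_real_sequentially assms(1)]
  unfolding occurrences_eq_sum by simp

text \<open>Kronecker's lemma with the count that includes the current step. Where
  \<open>p m\<close> holds this count is at least 1, so multiplying by it restores the term.\<close>

lemma average_at_occurrences_tendsto_0:
  fixes \<xi> :: "nat \<Rightarrow> real"
  assumes p: "filterlim (occurrences p) at_top sequentially"
    and \<xi>: "convergent (\<lambda>n. \<Sum>m<n. of_bool (p m) * \<xi> m / real (occurrences p (Suc m)))"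
  shows "(\<lambda>n. (\<Sum>m<n. of_bool (p m) * \<xi> m) / real (occurrences p n)) \<longlonglongrightarrow> 0"
proof -
  have "real (occurrences p (Suc m)) * (of_bool (p m) * \<xi> m / real (occurrences p (Suc m))) = of_bool (p m) * \<xi> m" for m
    by (simp add: occurrences_Suc)
  moreover have "filterlim (\<lambda>n. real (occurrences p (Suc n))) at_top sequentially"
    by (rule filterlim_compose[OF filterlim_compose[OF filterlim_real_sequentially p] filterlim_Suc])
  ultimately have "(\<lambda>n. (\<Sum>m<Suc n. of_bool (p m) * \<xi> m) / real (occurrences p (Suc n))) \<longlonglongrightarrow> 0"
    using kronecker[of "\<lambda>n. real (occurrences p (Suc n))", OF _ _ \<xi>] monoD[OF mono_occurrences] by simp
  then show ?thesis by (rule LIMSEQ_imp_Suc)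
qed

section \<open>Truncation of a single noise value\<close>

definition truncate :: "nat \<Rightarrow> real \<Rightarrow> real" where
  "truncate k w = w * of_bool (\<bar>w\<bar> \<le> real k)"

lemma truncate_measurable [measurable]: "truncate k \<in> borel_measurable borel"
proof -
  have "truncate k = (\<lambda>w. if \<bar>w\<bar> \<le> real k then w else 0)" by (auto simp: truncate_def)
  then show ?thesis by simp
qed

lemma abs_truncate_le: "\<bar>truncate k w\<bar> \<le> real k" "\<bar>truncate k w\<bar> \<le> \<bar>w\<bar>"
  by (auto simp: truncate_def)

lemma truncate_tendsto: "(\<lambda>k. truncate k w) \<longlonglongrightarrow> w"
proof (rule tendsto_eventually)
  obtain N where "\<bar>w\<bar> \<le> real N" using real_arch_simple by blast
  then show "\<forall>\<^sub>F k in sequentially. truncate k w = w"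
    by (intro eventually_sequentiallyI[of N]) (auto simp: truncate_def)
qed

text \<open>Only indices from about \<open>\<bar>w\<bar>\<close> on contribute, where the tail of
  the inverse squares is of order \<open>1 / \<bar>w\<bar>\<close>. Since the bound is linear in
  \<open>\<bar>w\<bar>\<close>, a first moment will control the sum of the truncated
  variances.\<close>

lemma sum_truncate_square_le:
  "(\<Sum>k<N. (truncate (Suc k) w)\<^sup>2 / (real (Suc k))\<^sup>2) \<le> 2 * \<bar>w\<bar>"
proof -
  \<comment> \<open>The slack \<open>w\<^sup>2 / real N\<close> pays for the next term, because
    1/(N+1)^2 <= 1/N - 1/(N+1).\<close>
  have "if \<bar>w\<bar> \<le> real N
    then (\<Sum>k<N. (truncate (Suc k) w)\<^sup>2 / (real (Suc k))\<^sup>2) \<le> 2 * \<bar>w\<bar> - w\<^sup>2 / real N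
    else (\<Sum>k<N. (truncate (Suc k) w)\<^sup>2 / (real (Suc k))\<^sup>2) = 0"
  proof (induction N)
    case (Suc N)
    \<comment> \<open>The case \<open>w = 0\<close> stands apart because at \<open>N = 0\<close> the
      slack is a division by zero. In the third case the first nonzero term enters.\<close>
    consider "\<bar>w\<bar> \<le> real N" "N > 0" | "w = 0" | "real N < \<bar>w\<bar>" "\<bar>w\<bar> \<le> real (Suc N)" | "real (Suc N) < \<bar>w\<bar>"
      by (cases "N = 0") fastforce+
    then show ?case
    proof cases
      case 1
      have "w\<^sup>2 / (real (Suc N))\<^sup>2 \<le> w\<^sup>2 * (1 / (real N * real (Suc N)))"
        using 1 by (simp add: power2_eq_square frac_le)
      also have "\<dots> = w\<^sup>2 / real N - w\<^sup>2 / real (Suc N)"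
        using 1 by (simp add: field_simps)
      finally show ?thesis using Suc 1 by (simp add: truncate_def)
    next
      case 2 then show ?thesis by (simp add: truncate_def)
    next
      case 3
      define r where "r = \<bar>w\<bar> / real (Suc N)"
      have r: "0 \<le> r" "r \<le> 1" "w\<^sup>2 / (real (Suc N))\<^sup>2 = r * r" "w\<^sup>2 / real (Suc N) = r * \<bar>w\<bar>"
        using 3 unfolding r_def by (auto simp: power2_eq_square abs_mult_self_eq)
      \<comment> \<open>The entering term is \<open>r * r\<close> and the slack to be created is
        \<open>r * \<bar>w\<bar>\<close>; each is at most \<open>\<bar>w\<bar>\<close>, whence the
        constant 2.\<close>
      have "r * r \<le> \<bar>w\<bar>"
      proof (cases "N = 0")
        case True then show ?thesis using r mult_left_le[of r r] by (simp add: r_def)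
      next
        case False
        then have "1 \<le> \<bar>w\<bar>" using 3 by linarith
        then show ?thesis using r mult_mono[of r 1 r 1] by simp
      qed
      moreover have "r * \<bar>w\<bar> \<le> \<bar>w\<bar>" using r by (simp add: mult_left_le_one_le)
      ultimately show ?thesis using Suc 3 r by (simp add: truncate_def)
    next
      case 4 then show ?thesis using Suc by (simp add: truncate_def)
    qed
  qed simp
  moreover have "w\<^sup>2 / real N \<ge> 0" by simp
  ultimately show ?thesis by (smt (verit))
qed

lemma suminf_truncate_square_le:
  "(\<Sum>k. ennreal ((truncate (Suc k) w)\<^sup>2 / (real (Suc k))\<^sup>2)) \<le> ennreal (2 * \<bar>w\<bar>)"
  by (rule suminf_le_const) (use sum_truncate_square_le in \<open>auto simp: ennreal_leI\<close>)

text \<open>The sum counts the positive integers below \<open>\<bar>w\<bar>\<close>. Its expectation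
  will bound the probabilities in the Borel-Cantelli lemma.\<close>

lemma suminf_of_bool_less_le: "(\<Sum>k. of_bool (real (Suc k) < \<bar>w\<bar>)) \<le> ennreal \<bar>w\<bar>"
proof (rule suminf_le_const)
  fix N
  have "(\<Sum>k<N. of_bool (real (Suc k) < \<bar>w\<bar>)) \<le> real N \<and> (\<Sum>k<N. of_bool (real (Suc k) < \<bar>w\<bar>)) \<le> \<bar>w\<bar>"
    by (induction N) auto
  moreover have "(\<Sum>k<N. of_bool (real (Suc k) < \<bar>w\<bar>)) = ennreal (\<Sum>k<N. of_bool (real (Suc k) < \<bar>w\<bar>))"
    by (induction N) (auto simp: of_bool_def)
  ultimately show "(\<Sum>k<N. of_bool (real (Suc k) < \<bar>w\<bar>)) \<le> ennreal \<bar>w\<bar>"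
    by (simp add: ennreal_leI)
qed simp

lemma of_bool_measurable [measurable (raw)]:
  "Measurable.pred M p \<Longrightarrow> (\<lambda>\<omega>. of_bool (p \<omega>) :: 'b::{zero_neq_one,topological_space}) \<in> borel_measurable M"
  unfolding of_bool_def by measurable

lemma occurrences_measurable [measurable (raw)]:
  assumes "\<And>m. m < n \<Longrightarrow> Measurable.pred M (p m)"
  shows "(\<lambda>\<omega>. occurrences (\<lambda>m. p m \<omega>) n) \<in> measurable M (count_space UNIV)"
  using assms
proof (induction n)
  case (Suc n)
  then have [measurable]: "(\<lambda>\<omega>. occurrences (\<lambda>m. p m \<omega>) n) \<in> measurable M (count_space UNIV)"
    "Measurable.pred M (p n)" by auto
  show ?case unfolding occurrences_Suc of_bool_def by measurable
qed simp

context adapted_space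
begin

text \<open>The count of index \<open>Suc n\<close> inspects \<open>p m\<close> for
  \<open>m \<le> n\<close> only, so it is known before the outcome of step \<open>n\<close> is
  drawn.\<close>

lemma occurrences_predictable:
  assumes "\<And>n. Measurable.pred (F n) (p n)"
  shows "(\<lambda>\<omega>. occurrences (\<lambda>m. p m \<omega>) (Suc n)) \<in> measurable (F n) (count_space UNIV)"
  using assms by (intro occurrences_measurable measurable_F_mono[OF assms]) auto

text \<open>After division by the count the second moments add up to at most
  \<open>C\<^sup>2\<close> times the sum of the inverse squares, however the occurrences are spread
  over time. Martingale convergence and Kronecker's lemma then apply.\<close>

lemma average_centered_tendsto_0:
  fixes \<xi> :: "nat \<Rightarrow> 'w \<Rightarrow> real"
  assumes p: "\<And>n. Measurable.pred (F n) (p n)"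
    and \<xi>: "bounded_mds (\<lambda>n \<omega>. of_bool (p n \<omega>) * \<xi> n \<omega>)"
  shows "AE \<omega> in M. filterlim (occurrences (\<lambda>n. p n \<omega>)) at_top sequentially \<longrightarrow>
    (\<lambda>n. (\<Sum>m<n. of_bool (p m \<omega>) * \<xi> m \<omega>) / real (occurrences (\<lambda>n. p n \<omega>) n)) \<longlonglongrightarrow> 0"
proof -
  define N where "N n \<omega> = occurrences (\<lambda>m. p m \<omega>) (Suc n)" for n \<omega>
  note N_F = occurrences_predictable[of p, OF p, folded N_def]
  note [measurable] = measurable_F[OF p] measurable_F[OF N_F]
  \<comment> \<open>A count of 0 gives the factor \<open>inverse 0 = 0\<close>, so the factor never
    exceeds 1 in absolute value.\<close>
  define D where "D n \<omega> = inverse (real (N n \<omega>)) * (of_bool (p n \<omega>) * \<xi> n \<omega>)" for n \<omega>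
  have "bounded_mds D"
    unfolding D_def
  proof (rule bounded_mds_mult[OF \<xi>])
    show "(\<lambda>\<omega>. inverse (real (N n \<omega>))) \<in> borel_measurable (F n)" for n
      using N_F[of n] by measurable
    show "\<bar>inverse (real (N n \<omega>))\<bar> \<le> 1" for n \<omega>
      by (cases "N n \<omega>") (auto simp: field_simps)
  qed
  note D = this
  have [measurable]: "D n \<in> borel_measurable M" for n
    using D unfolding bounded_mds_def by (blast intro: measurable_F)
  obtain C where C: "\<And>n \<omega>. \<bar>of_bool (p n \<omega>) * \<xi> n \<omega>\<bar> \<le> C" using \<xi> unfolding bounded_mds_def by blast
  have D2: "ennreal ((D n \<omega>)\<^sup>2) \<le> of_bool (p n \<omega>) * ennreal (C\<^sup>2 * inverse ((real (N n \<omega>))\<^sup>2))" for n \<omega>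
  proof -
    have "(of_bool (p n \<omega>) * \<xi> n \<omega>)\<^sup>2 \<le> C\<^sup>2" using power_mono[OF C[of n \<omega>] abs_ge_zero, of 2] by simp
    then show ?thesis
      by (auto simp: D_def power_mult_distrib power_inverse[symmetric] mult.commute intro!: mult_right_mono ennreal_leI)
  qed
  \<comment> \<open>The bound on the random sum holds path by path, so the sum is moved inside the
    integral before the bound is applied.\<close>
  have "(\<Sum>n. ennreal (\<integral>\<omega>. (D n \<omega>)\<^sup>2 \<partial>M)) \<noteq> \<top>"
  proof -
    have s: "summable (\<lambda>k. C\<^sup>2 * inverse ((real (Suc k))\<^sup>2))"
      using inverse_power_summable[of 2, where ?'a = real] by (subst summable_Suc_iff) (intro summable_mult, simp)
    obtain C' where C': "\<And>n \<omega>. \<bar>D n \<omega>\<bar> \<le> C'" using D unfolding bounded_mds_def by blast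
    have "integrable M (\<lambda>\<omega>. (D n \<omega>)\<^sup>2)" for n
      using power_mono[OF C' abs_ge_zero, of _ _ 2] by (intro integrable_bounded[where C = "C'\<^sup>2"]) auto
    then have "(\<Sum>n. ennreal (\<integral>\<omega>. (D n \<omega>)\<^sup>2 \<partial>M)) = (\<integral>\<^sup>+\<omega>. (\<Sum>n. ennreal ((D n \<omega>)\<^sup>2)) \<partial>M)"
      by (simp add: nn_integral_suminf nn_integral_eq_integral)
    also have "\<dots> \<le> (\<integral>\<^sup>+\<omega>. (\<Sum>n. of_bool (p n \<omega>) * ennreal (C\<^sup>2 * inverse ((real (N n \<omega>))\<^sup>2))) \<partial>M)"
      by (intro nn_integral_mono suminf_le D2) simp_all
    also have "\<dots> \<le> (\<integral>\<^sup>+\<omega>. (\<Sum>k. ennreal (C\<^sup>2 * inverse ((real (Suc k))\<^sup>2))) \<partial>M)"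
      unfolding N_def by (intro nn_integral_mono suminf_over_occurrences_le)
    also have "\<dots> < \<top>"
      using s by (simp add: emeasure_space_1 suminf_ennreal_eq[OF _ summable_sums])
    finally show ?thesis by simp
  qed
  then have "summable (\<lambda>n. \<integral>\<omega>. (D n \<omega>)\<^sup>2 \<partial>M)"
    by (intro summable_suminf_not_top) auto
  then have "AE \<omega> in M. convergent (\<lambda>n. \<Sum>m<n. D m \<omega>)" by (rule bounded_mds_convergent[OF D])
  then show ?thesis
  proof eventually_elim
    case (elim \<omega>)
    then show ?case
      using average_at_occurrences_tendsto_0[of "\<lambda>n. p n \<omega>" "\<lambda>n. \<xi> n \<omega>"]
      unfolding D_def N_def by (simp add: field_simps)
  qed
qed

text \<open>Translates independence of the noise from the sigma-algebra \<open>F n\<close> into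
  independence of random variables, for anything known at step \<open>n\<close>.\<close>

lemma indep_var_past:
  assumes "indep_set (sets (F n)) (sets (vimage_algebra (space M) Y borel))"
    and X: "X \<in> measurable (F n) S" and Y: "random_variable borel Y"
  shows "indep_var S X borel Y"
  unfolding indep_var_eq
proof (intro conjI Y measurable_F[OF X])
  have "sigma_sets (space M) {X -` A \<inter> space M |A. A \<in> sets S} \<subseteq> sets (F n)"
    using sets.sigma_sets_subset[of "{X -` A \<inter> space M |A. A \<in> sets S}" "F n"] measurable_sets[OF X]
    by (auto simp: space_F)
  moreover have "sigma_sets (space M) {Y -` A \<inter> space M |A. A \<in> sets borel}
      = sets (vimage_algebra (space M) Y borel)"
    by (simp add: sets_vimage_algebra)
  ultimately show "indep_set (sigma_sets (space M) {X -` A \<inter> space M |A. A \<in> sets S})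
      (sigma_sets (space M) {Y -` A \<inter> space M |A. A \<in> sets borel})"
    using assms(1) unfolding indep_sets2_eq by auto
qed

end

lemma (in prob_space) indep_var_nn_integral:
  fixes X Y :: "'a \<Rightarrow> ennreal"
  assumes "indep_var borel X borel Y"
  shows "(\<integral>\<^sup>+\<omega>. X \<omega> * Y \<omega> \<partial>M) = (\<integral>\<^sup>+\<omega>. X \<omega> \<partial>M) * (\<integral>\<^sup>+\<omega>. Y \<omega> \<partial>M)"
proof -
  have *: "(\<lambda>_. borel) = case_bool borel borel"
    by (auto split: bool.split)
  have "indep_vars (\<lambda>_. borel) (case_bool X Y) UNIV"
    unfolding * using assms by (simp add: indep_var_def)
  from indep_vars_nn_integral[OF _ this] show ?thesis
    by (simp add: UNIV_bool mult.commute)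
qed


subsection \<open>The strong law for noise sampled at predictable times\<close>

locale iid_noise = adapted_space M F
  for M :: "'w measure" and F :: "nat \<Rightarrow> 'w measure" +
  fixes W :: "'w \<Rightarrow> nat \<Rightarrow> real"
  assumes noise_measurable: "(\<lambda>\<omega>. W \<omega> n) \<in> borel_measurable (F (Suc n))"
    and noise_indep: "indep_set (sets (F n)) (sets (vimage_algebra (space M) (\<lambda>\<omega>. W \<omega> n) borel))"
    and noise_distr: "distr M borel (\<lambda>\<omega>. W \<omega> n) = distr M borel (\<lambda>\<omega>. W \<omega> 0)"
    and noise_integrable: "integrable M (\<lambda>\<omega>. W \<omega> 0)"
    and noise_mean: "expectation (\<lambda>\<omega>. W \<omega> 0) = 0"
begin

lemma noise_random_variable [measurable]: "(\<lambda>\<omega>. W \<omega> n) \<in> borel_measurable M"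
  by (rule measurable_F[OF noise_measurable])

lemma expectation_noise:
  fixes f :: "real \<Rightarrow> real"
  assumes [measurable]: "f \<in> borel_measurable borel"
  shows "(\<integral>\<omega>. f (W \<omega> n) \<partial>M) = (\<integral>\<omega>. f (W \<omega> 0) \<partial>M)"
  using integral_distr[of "\<lambda>\<omega>. W \<omega> n" M borel f] integral_distr[of "\<lambda>\<omega>. W \<omega> 0" M borel f]
  by (simp add: noise_distr[of n])

lemma nn_integral_noise:
  assumes [measurable]: "f \<in> borel_measurable borel"
  shows "(\<integral>\<^sup>+\<omega>. f (W \<omega> n) \<partial>M) = (\<integral>\<^sup>+\<omega>. f (W \<omega> 0) \<partial>M)"
  using nn_integral_distr[of "\<lambda>\<omega>. W \<omega> n" M borel f] nn_integral_distr[of "\<lambda>\<omega>. W \<omega> 0" M borel f]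
  by (simp add: noise_distr[of n])

text \<open>A freezing argument: \<open>\<kappa>\<close> is independent of the noise of step
  \<open>n\<close>, so the noise can be integrated first with the level held fixed, and equality of
  distributions replaces it by the noise of step 0.\<close>

lemma nn_integral_past_noise:
  fixes h :: "nat \<Rightarrow> real \<Rightarrow> ennreal"
  assumes \<kappa>: "\<kappa> \<in> measurable (F n) (count_space UNIV)"
    and h[measurable]: "\<And>k. h k \<in> borel_measurable borel"
  shows "(\<integral>\<^sup>+\<omega>. h (\<kappa> \<omega>) (W \<omega> n) \<partial>M) = (\<integral>\<^sup>+\<omega>. (\<integral>\<^sup>+\<omega>'. h (\<kappa> \<omega>) (W \<omega>' 0) \<partial>M) \<partial>M)"
proof -
  note [measurable] = measurable_F[OF \<kappa>]
  \<comment> \<open>Splitting over the countably many levels leaves products of independent factors;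
    nonnegativity permits the interchanges.\<close>
  have split: "f (\<kappa> \<omega>) = (\<Sum>k. of_bool (\<kappa> \<omega> = k) * f k)" for f :: "nat \<Rightarrow> ennreal" and \<omega>
    by (subst suminf_finite[of "{\<kappa> \<omega>}"]) auto
  have "(\<integral>\<^sup>+\<omega>. h (\<kappa> \<omega>) (W \<omega> n) \<partial>M) = (\<Sum>k. \<integral>\<^sup>+\<omega>. of_bool (\<kappa> \<omega> = k) * h k (W \<omega> n) \<partial>M)"
    by (subst split) (simp add: nn_integral_suminf)
  also have "\<dots> = (\<Sum>k. (\<integral>\<^sup>+\<omega>. of_bool (\<kappa> \<omega> = k) \<partial>M) * (\<integral>\<^sup>+\<omega>. h k (W \<omega> 0) \<partial>M))"
  proof (intro suminf_cong)
    fix k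
    have "indep_var borel (\<lambda>\<omega>. of_bool (\<kappa> \<omega> = k) :: real) borel (\<lambda>\<omega>. W \<omega> n)"
      by (intro indep_var_past[OF noise_indep] measurable_compose[OF \<kappa>]) simp_all
    from indep_var_compose[OF this measurable_ennreal h[of k]]
    have "indep_var borel (\<lambda>\<omega>. of_bool (\<kappa> \<omega> = k) :: ennreal) borel (\<lambda>\<omega>. h k (W \<omega> n))"
      by (simp add: comp_def of_bool_def if_distrib cong: if_cong)
    then show "(\<integral>\<^sup>+\<omega>. of_bool (\<kappa> \<omega> = k) * h k (W \<omega> n) \<partial>M)
        = (\<integral>\<^sup>+\<omega>. of_bool (\<kappa> \<omega> = k) \<partial>M) * (\<integral>\<^sup>+\<omega>. h k (W \<omega> 0) \<partial>M)"
      by (simp add: indep_var_nn_integral nn_integral_noise[of "h k" n])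
  qed
  also have "\<dots> = (\<integral>\<^sup>+\<omega>. (\<integral>\<^sup>+\<omega>'. h (\<kappa> \<omega>) (W \<omega>' 0) \<partial>M) \<partial>M)"
    by (subst split[of "\<lambda>k. \<integral>\<^sup>+\<omega>'. h k (W \<omega>' 0) \<partial>M"]) (simp add: nn_integral_suminf nn_integral_multc)
  finally show ?thesis .
qed

text \<open>The signed counterpart of the freezing argument. The bound on \<open>\<kappa>\<close>
  keeps the sum over levels finite, so linearity of the integral suffices.\<close>

lemma integral_past_noise_eq_0:
  fixes f :: "nat \<Rightarrow> real \<Rightarrow> real"
  assumes \<kappa>: "\<kappa> \<in> measurable (F n) (count_space UNIV)" "\<And>\<omega>. \<kappa> \<omega> \<le> K"
    and f[measurable]: "\<And>k. f k \<in> borel_measurable borel"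
    and int: "\<And>k. integrable M (\<lambda>\<omega>. f k (W \<omega> n))" and zero: "\<And>k. (\<integral>\<omega>. f k (W \<omega> 0) \<partial>M) = 0"
    and A: "A \<in> sets (F n)"
  shows "(\<integral>\<omega>. indicator A \<omega> * f (\<kappa> \<omega>) (W \<omega> n) \<partial>M) = 0"
proof -
  have \<kappa>M[measurable]: "\<kappa> \<in> measurable M (count_space UNIV)" by (rule measurable_F[OF \<kappa>(1)])
  have AM[measurable]: "A \<in> sets M" using A sets_F by auto
  have prod: "integrable M (\<lambda>\<omega>. indicator A \<omega> * of_bool (\<kappa> \<omega> = k) * f k (W \<omega> n))"
    "(\<integral>\<omega>. indicator A \<omega> * of_bool (\<kappa> \<omega> = k) * f k (W \<omega> n) \<partial>M) = 0" for k
  proof -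
    have "indep_var borel (\<lambda>\<omega>. indicator A \<omega> * of_bool (\<kappa> \<omega> = k) :: real) borel (\<lambda>\<omega>. W \<omega> n)"
      using A by (intro indep_var_past[OF noise_indep] borel_measurable_times
          measurable_compose[OF \<kappa>(1)]) simp_all
    from indep_var_compose[OF this measurable_ident f[of k]]
    have ind: "indep_var borel (\<lambda>\<omega>. indicator A \<omega> * of_bool (\<kappa> \<omega> = k) :: real) borel (\<lambda>\<omega>. f k (W \<omega> n))"
      by (simp add: comp_def)
    have i1: "integrable M (\<lambda>\<omega>. indicator A \<omega> * of_bool (\<kappa> \<omega> = k) :: real)"
      by (rule integrable_bounded[of _ 1]) (auto simp: indicator_def)
    show "integrable M (\<lambda>\<omega>. indicator A \<omega> * of_bool (\<kappa> \<omega> = k) * f k (W \<omega> n))"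
      by (rule indep_var_integrable[OF ind i1 int])
    show "(\<integral>\<omega>. indicator A \<omega> * of_bool (\<kappa> \<omega> = k) * f k (W \<omega> n) \<partial>M) = 0"
      using indep_var_lebesgue_integral[OF ind i1 int] expectation_noise[of "f k" n] zero[of k] by simp
  qed
  have "indicator A \<omega> * f (\<kappa> \<omega>) (W \<omega> n) = (\<Sum>k\<le>K. indicator A \<omega> * of_bool (\<kappa> \<omega> = k) * f k (W \<omega> n))" for \<omega>
  proof -
    have "(\<Sum>k\<le>K. indicator A \<omega> * of_bool (\<kappa> \<omega> = k) * f k (W \<omega> n))
        = (\<Sum>k\<in>{\<kappa> \<omega>}. indicator A \<omega> * of_bool (\<kappa> \<omega> = k) * f k (W \<omega> n))"
      using \<kappa>(2) by (intro sum.mono_neutral_right) auto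
    also have "\<dots> = indicator A \<omega> * f (\<kappa> \<omega>) (W \<omega> n)" by (cases "\<omega> \<in> A") simp_all
    finally show ?thesis by (rule sym)
  qed
  then show ?thesis using prod by simp
qed

definition truncated_mean :: "nat \<Rightarrow> real" where
  "truncated_mean k = (\<integral>\<omega>. truncate k (W \<omega> 0) \<partial>M)"

text \<open>Truncation destroys mean zero; by dominated convergence the resulting bias is
  asymptotically negligible.\<close>

lemma truncated_mean_tendsto_0: "truncated_mean \<longlonglongrightarrow> 0"
proof -
  have "(\<lambda>k. \<integral>\<omega>. truncate k (W \<omega> 0) \<partial>M) \<longlonglongrightarrow> (\<integral>\<omega>. W \<omega> 0 \<partial>M)"
    by (rule integral_dominated_convergence[where w = "\<lambda>\<omega>. \<bar>W \<omega> 0\<bar>"])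
      (use noise_integrable in \<open>auto simp: abs_truncate_le truncate_tendsto\<close>)
  then show ?thesis by (simp add: truncated_mean_def[abs_def] noise_mean)
qed

lemma integrable_truncate [simp]: "integrable M (\<lambda>\<omega>. truncate k (W \<omega> n))"
  by (rule integrable_bounded[OF _ abs_truncate_le(1)]) measurable

lemma abs_truncated_mean_le: "\<bar>truncated_mean k\<bar> \<le> real k"
proof -
  have "\<bar>truncated_mean k\<bar> \<le> (\<integral>\<omega>. \<bar>truncate k (W \<omega> 0)\<bar> \<partial>M)"
    unfolding truncated_mean_def by (rule integral_abs_bound)
  also have "\<dots> \<le> real k"
    by (rule integral_le_const) (auto simp: abs_truncate_le)
  finally show ?thesis .
qed

text \<open>Division by zero gives \<open>scaled_truncation 0 w = 0\<close>.\<close>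

definition scaled_truncation :: "nat \<Rightarrow> real \<Rightarrow> real" where
  "scaled_truncation k w = (truncate k w - truncated_mean k) / real k"

lemma scaled_truncation_measurable [measurable]: "scaled_truncation k \<in> borel_measurable borel"
  unfolding scaled_truncation_def by measurable

lemma abs_scaled_truncation_le: "\<bar>scaled_truncation k w\<bar> \<le> 2"
  using abs_truncate_le(1)[of k w] abs_truncated_mean_le[of k]
  by (cases "k = 0") (auto simp: scaled_truncation_def divide_le_eq)

lemma integral_scaled_truncation: "(\<integral>\<omega>. scaled_truncation k (W \<omega> 0) \<partial>M) = 0"
  unfolding scaled_truncation_def by (simp add: truncated_mean_def prob_space)

text \<open>A variance is at most the second moment, so the elementary bound for uncentred
  truncations carries over.\<close>

lemma nn_integral_scaled_truncation_square:
  "(\<integral>\<^sup>+\<omega>. ennreal ((scaled_truncation k (W \<omega> 0))\<^sup>2) \<partial>M)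
    \<le> (\<integral>\<^sup>+\<omega>. ennreal ((truncate k (W \<omega> 0))\<^sup>2 / (real k)\<^sup>2) \<partial>M)"
proof -
  have i: "integrable M (\<lambda>\<omega>. (truncate k (W \<omega> 0))\<^sup>2)"
    using power_mono[OF abs_truncate_le(1) abs_ge_zero, of k _ 2]
    by (intro integrable_bounded[where C = "(real k)\<^sup>2"]) auto
  have i': "integrable M (\<lambda>\<omega>. (scaled_truncation k (W \<omega> 0))\<^sup>2)"
    using power_mono[OF abs_scaled_truncation_le abs_ge_zero, of k _ 2]
    by (intro integrable_bounded[where C = "2\<^sup>2"]) auto
  have "(\<integral>\<omega>. (scaled_truncation k (W \<omega> 0))\<^sup>2 \<partial>M) = variance (\<lambda>\<omega>. truncate k (W \<omega> 0)) / (real k)\<^sup>2"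
    unfolding scaled_truncation_def truncated_mean_def by (simp add: power_divide)
  also have "\<dots> \<le> (\<integral>\<omega>. (truncate k (W \<omega> 0))\<^sup>2 \<partial>M) / (real k)\<^sup>2"
    using variance_eq[OF integrable_truncate i] by (intro divide_right_mono) auto
  also have "\<dots> = (\<integral>\<omega>. (truncate k (W \<omega> 0))\<^sup>2 / (real k)\<^sup>2 \<partial>M)" by simp
  finally show ?thesis
    using i i' by (subst (1 2) nn_integral_eq_integral) (auto simp: ennreal_leI)
qed

lemma nn_integral_abs_noise_finite: "(\<integral>\<^sup>+\<omega>. ennreal (c * \<bar>W \<omega> 0\<bar>) \<partial>M) < \<top>" if "c \<ge> 0"
proof -
  have "integrable M (\<lambda>\<omega>. c * \<bar>W \<omega> 0\<bar>)" using noise_integrable by simp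
  then show ?thesis using that by (subst nn_integral_eq_integral) auto
qed


text \<open>At an occurrence the noise splits into a centred truncation, the bias of the truncation
  and the excess over the level. Martingale convergence with Kronecker's lemma handles the first,
  dominated convergence the second, Borel-Cantelli the third.\<close>

theorem average_noise_tendsto_0:
  assumes p: "\<And>n. Measurable.pred (F n) (p n)"
  shows "AE \<omega> in M. filterlim (occurrences (\<lambda>n. p n \<omega>)) at_top sequentially \<longrightarrow>
    (\<lambda>n. (\<Sum>m<n. of_bool (p m \<omega>) * W \<omega> m) / real (occurrences (\<lambda>n. p n \<omega>) n)) \<longlonglongrightarrow> 0"
proof -
  define N where "N n \<omega> = occurrences (\<lambda>m. p m \<omega>) (Suc n)" for n \<omega>
  note N_F = occurrences_predictable[of p, OF p, folded N_def]
  \<comment> \<open>Noise is truncated at the number of occurrences so far, which is known before the noise is drawn;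
    the value 0 stands for no occurrence.\<close>
  define \<kappa> where "\<kappa> n \<omega> = (if p n \<omega> then N n \<omega> else 0)" for n \<omega>
  have \<kappa>_F: "\<kappa> n \<in> measurable (F n) (count_space UNIV)" for n
    unfolding \<kappa>_def using p[of n] N_F[of n] by measurable
  note [measurable] = measurable_F[OF p] measurable_F[OF N_F] measurable_F[OF \<kappa>_F]
  have \<kappa>_le: "\<kappa> n \<omega> \<le> Suc n" for n \<omega>
    unfolding \<kappa>_def N_def using occurrences_le by auto
  \<comment> \<open>With \<open>h 0 = 0\<close> the steps without an occurrence drop out, and the
    others use each level at most once.\<close>
  have suminf_\<kappa>: "(\<Sum>n. h (\<kappa> n \<omega>)) \<le> (\<Sum>k. h (Suc k))" if "h 0 = 0" for h :: "nat \<Rightarrow> ennreal" and \<omega>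
  proof -
    have "h (\<kappa> n \<omega>) = of_bool (p n \<omega>) * h (N n \<omega>)" for n using that by (simp add: \<kappa>_def)
    then show ?thesis using suminf_over_occurrences_le[of "\<lambda>n. p n \<omega>" h] by (simp add: N_def)
  qed
  \<comment> \<open>Freezing the level and then counting levels path by path replaces the random
    times by a deterministic series in one noise variable. It is applied to the variances and to the
    exceedance probabilities.\<close>
  have total: "(\<Sum>n. \<integral>\<^sup>+\<omega>. h (\<kappa> n \<omega>) (W \<omega> n) \<partial>M) \<le> (\<Sum>k. \<integral>\<^sup>+\<omega>. h (Suc k) (W \<omega> 0) \<partial>M)"
    if [measurable]: "\<And>k. h k \<in> borel_measurable borel" and "\<And>w. h 0 w = 0" for h :: "nat \<Rightarrow> real \<Rightarrow> ennreal"
  proof -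
    have "(\<Sum>n. \<integral>\<^sup>+\<omega>. h (\<kappa> n \<omega>) (W \<omega> n) \<partial>M) = (\<integral>\<^sup>+\<omega>. (\<Sum>n. \<integral>\<^sup>+\<omega>'. h (\<kappa> n \<omega>) (W \<omega>' 0) \<partial>M) \<partial>M)"
      by (simp add: nn_integral_past_noise[OF \<kappa>_F] nn_integral_suminf)
    also have "\<dots> \<le> (\<integral>\<^sup>+\<omega>. (\<Sum>k. \<integral>\<^sup>+\<omega>'. h (Suc k) (W \<omega>' 0) \<partial>M) \<partial>M)"
      by (intro nn_integral_mono suminf_\<kappa>) (simp add: that)
    finally show ?thesis by (simp add: emeasure_space_1)
  qed

  define D where "D n \<omega> = scaled_truncation (\<kappa> n \<omega>) (W \<omega> n)" for n \<omega>
  have D_F: "D n \<in> borel_measurable (F (Suc n))" for n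
  proof -
    have "\<kappa> n \<in> measurable (F (Suc n)) (count_space UNIV)"
      by (rule measurable_F_mono[OF \<kappa>_F]) simp
    then show ?thesis unfolding D_def
      by (rule measurable_compose_countable[rotated])
        (rule measurable_compose[OF noise_measurable scaled_truncation_measurable])
  qed
  have D: "bounded_mds D"
    unfolding bounded_mds_def
  proof (intro conjI allI ballI exI)
    show "\<bar>D n \<omega>\<bar> \<le> 2" for n \<omega> unfolding D_def by (rule abs_scaled_truncation_le)
    show "(\<integral>\<omega>. indicator A \<omega> * D n \<omega> \<partial>M) = 0" if "A \<in> sets (F n)" for n A
      unfolding D_def
      by (rule integral_past_noise_eq_0[OF \<kappa>_F \<kappa>_le _ _ _ that])
        (auto intro!: integrable_bounded abs_scaled_truncation_le integral_scaled_truncation)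
  qed (rule D_F)
  have [measurable]: "D n \<in> borel_measurable M" for n by (rule measurable_F[OF D_F])
  have "(\<Sum>n. ennreal (\<integral>\<omega>. (D n \<omega>)\<^sup>2 \<partial>M)) \<noteq> \<top>"
  proof -
    have "integrable M (\<lambda>\<omega>. (D n \<omega>)\<^sup>2)" for n
      using power_mono[OF abs_scaled_truncation_le abs_ge_zero, of _ _ 2] unfolding D_def[symmetric]
      by (intro integrable_bounded[where C = "2\<^sup>2"]) (auto simp: D_def)
    then have "(\<Sum>n. ennreal (\<integral>\<omega>. (D n \<omega>)\<^sup>2 \<partial>M))
        = (\<Sum>n. \<integral>\<^sup>+\<omega>. ennreal ((scaled_truncation (\<kappa> n \<omega>) (W \<omega> n))\<^sup>2) \<partial>M)"
      by (simp add: nn_integral_eq_integral D_def)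
    also have "\<dots> \<le> (\<Sum>k. \<integral>\<^sup>+\<omega>. ennreal ((scaled_truncation (Suc k) (W \<omega> 0))\<^sup>2) \<partial>M)"
      by (rule total) (auto simp: scaled_truncation_def[of 0])
    also have "\<dots> \<le> (\<Sum>k. \<integral>\<^sup>+\<omega>. ennreal ((truncate (Suc k) (W \<omega> 0))\<^sup>2 / (real (Suc k))\<^sup>2) \<partial>M)"
      by (intro suminf_le nn_integral_scaled_truncation_square) auto
    also have "\<dots> = (\<integral>\<^sup>+\<omega>. (\<Sum>k. ennreal ((truncate (Suc k) (W \<omega> 0))\<^sup>2 / (real (Suc k))\<^sup>2)) \<partial>M)"
      by (rule nn_integral_suminf[symmetric]) measurable
    also have "\<dots> \<le> (\<integral>\<^sup>+\<omega>. ennreal (2 * \<bar>W \<omega> 0\<bar>) \<partial>M)"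
      by (intro nn_integral_mono suminf_truncate_square_le)
    also have "\<dots> < \<top>" by (rule nn_integral_abs_noise_finite) simp
    finally show ?thesis by simp
  qed
  then have "summable (\<lambda>n. \<integral>\<omega>. (D n \<omega>)\<^sup>2 \<partial>M)"
    by (intro summable_suminf_not_top) auto
  then have conv: "AE \<omega> in M. convergent (\<lambda>n. \<Sum>m<n. D m \<omega>)" by (rule bounded_mds_convergent[OF D])

  \<comment> \<open>At an occurrence, \<open>B n\<close> says that truncation changes the noise;
    \<open>0 < \<kappa> n \<omega>\<close> excludes all other steps.\<close>
  define B where "B n = {\<omega> \<in> space M. 0 < \<kappa> n \<omega> \<and> real (\<kappa> n \<omega>) < \<bar>W \<omega> n\<bar>}" for n
  have B_M[measurable]: "B n \<in> sets M" for n unfolding B_def by measurable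
  have "(\<Sum>n. ennreal (prob (B n))) \<noteq> \<top>"
  proof -
    have "ennreal (prob (B n)) = (\<integral>\<^sup>+\<omega>. of_bool (0 < \<kappa> n \<omega> \<and> real (\<kappa> n \<omega>) < \<bar>W \<omega> n\<bar>) \<partial>M)" for n
    proof -
      have "ennreal (prob (B n)) = (\<integral>\<^sup>+\<omega>. indicator (B n) \<omega> \<partial>M)" by (simp add: emeasure_eq_measure)
      also have "\<dots> = (\<integral>\<^sup>+\<omega>. of_bool (0 < \<kappa> n \<omega> \<and> real (\<kappa> n \<omega>) < \<bar>W \<omega> n\<bar>) \<partial>M)"
        by (intro nn_integral_cong) (auto simp: B_def)
      finally show ?thesis .
    qed
    then have "(\<Sum>n. ennreal (prob (B n))) \<le> (\<Sum>k. \<integral>\<^sup>+\<omega>. of_bool (0 < Suc k \<and> real (Suc k) < \<bar>W \<omega> 0\<bar>) \<partial>M)"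
      by (simp only:) (rule total[of "\<lambda>k w. of_bool (0 < k \<and> real k < \<bar>w\<bar>)"], auto)
    also have "\<dots> = (\<integral>\<^sup>+\<omega>. (\<Sum>k. of_bool (real (Suc k) < \<bar>W \<omega> 0\<bar>)) \<partial>M)"
      by (subst nn_integral_suminf[symmetric]) simp_all
    also have "\<dots> \<le> (\<integral>\<^sup>+\<omega>. ennreal (1 * \<bar>W \<omega> 0\<bar>) \<partial>M)"
      using suminf_of_bool_less_le by (intro nn_integral_mono) simp
    also have "\<dots> < \<top>" by (rule nn_integral_abs_noise_finite) simp
    finally show ?thesis by simp
  qed
  then have "summable (\<lambda>n. prob (B n))"
    by (intro summable_suminf_not_top) auto
  then have "AE \<omega> in M. \<forall>\<^sub>F n in sequentially. \<omega> \<in> space M - B n"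
    by (intro borel_cantelli_AE1 B_M) (simp_all add: emeasure_eq_measure)
  with conv show ?thesis
  proof eventually_elim
    case (elim \<omega>)
    let ?p = "\<lambda>n. p n \<omega>"
    define \<xi> where "\<xi> n = truncate (N n \<omega>) (W \<omega> n) - truncated_mean (N n \<omega>)" for n
    \<comment> \<open>Bias and excess together. The excess is set to 0 away from the occurrences,
      where \<open>B n\<close> gives no control, so that \<open>y\<close> converges as an ordinary
      sequence.\<close>
    define y where "y n = (if p n \<omega> then W \<omega> n - truncate (N n \<omega>) (W \<omega> n) else 0) + truncated_mean (N n \<omega>)" for n
    show ?case
    proof
      assume p: "filterlim (occurrences ?p) at_top sequentially"
      have "of_bool (p m \<omega>) * \<xi> m / real (N m \<omega>) = D m \<omega>" for m
        by (simp add: \<xi>_def D_def \<kappa>_def scaled_truncation_def)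
      with elim(1) have "(\<lambda>n. (\<Sum>m<n. of_bool (p m \<omega>) * \<xi> m) / real (occurrences ?p n)) \<longlonglongrightarrow> 0"
        by (intro average_at_occurrences_tendsto_0[OF p]) (simp add: N_def)
      moreover have "(\<lambda>n. (\<Sum>m<n. of_bool (p m \<omega>) * y m) / real (occurrences ?p n)) \<longlonglongrightarrow> 0 + 0"
        unfolding y_def
      proof (intro average_at_occurrences_tendsto[OF p] tendsto_add)
        show "(\<lambda>n. truncated_mean (N n \<omega>)) \<longlonglongrightarrow> 0"
          unfolding N_def
          by (rule filterlim_compose[OF truncated_mean_tendsto_0 filterlim_compose[OF p filterlim_Suc]])
        have "\<forall>\<^sub>F n in sequentially. (if p n \<omega> then W \<omega> n - truncate (N n \<omega>) (W \<omega> n) else 0) = 0"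
          using elim(2)
        proof eventually_elim
          case (elim n)
          then show ?case by (auto simp: B_def \<kappa>_def truncate_def N_def occurrences_Suc not_less)
        qed
        then show "(\<lambda>n. if p n \<omega> then W \<omega> n - truncate (N n \<omega>) (W \<omega> n) else 0) \<longlonglongrightarrow> 0"
          by (rule tendsto_eventually)
      qed
      ultimately have "(\<lambda>n. (\<Sum>m<n. of_bool (p m \<omega>) * \<xi> m) / real (occurrences ?p n)
          + (\<Sum>m<n. of_bool (p m \<omega>) * y m) / real (occurrences ?p n)) \<longlonglongrightarrow> 0 + (0 + 0)"
        by (rule tendsto_add)
      moreover have "of_bool (p m \<omega>) * W \<omega> m = of_bool (p m \<omega>) * \<xi> m + of_bool (p m \<omega>) * y m" for m
        by (simp add: \<xi>_def y_def)
      ultimately show "(\<lambda>n. (\<Sum>m<n. of_bool (p m \<omega>) * W \<omega> m) / real (occurrences ?p n)) \<longlonglongrightarrow> 0"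
        by (simp add: sum.distrib add_divide_distrib)
    qed
  qed
qed

end

subsection \<open>Bellman deviations\<close>

lemma length_visits: "length (visits x u t i j) = occurrences (\<lambda>n. x n = i \<and> u n = j) t"
  by (simp add: visits_def occurrences_def length_filter_conv_card cong: conj_cong)

lemma sum_list_visits:
  "sum_list (map f (visits x u t i j)) = (\<Sum>n<t. of_bool (x n = i \<and> u n = j) * f n :: real)"
  by (induction t) (auto simp: visits_def)

lemma mean_deviation_eq:
  "mean_deviation R \<gamma> Q x u w t i j =
     (\<Sum>n<t. of_bool (x n = i \<and> u n = j) * (Q i j - R i j $ x (Suc n) - w n - \<gamma> * state_values Q $ x (Suc n)))
       / real (occurrences (\<lambda>n. x n = i \<and> u n = j) t)"
  by (simp only: mean_deviation_def deviations_def sum_list_visits length_visits)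

lemma deviations_near_mono: "deviations_near R \<gamma> Q x u w L \<delta> k \<Longrightarrow> k \<le> l \<Longrightarrow> deviations_near R \<gamma> Q x u w L \<delta> l"
  unfolding deviations_near_def by (meson order_trans)

text \<open>Convergence in \<open>t\<close> has to become a statement in the number of visits. If
  the visits to a pair are bounded, a larger \<open>k\<close> makes the claim vacuous; otherwise
  \<open>k\<close> exceeds the count at the time \<open>T\<close> from which the mean is close, and
  so many visits are reached only after \<open>T\<close>.\<close>

lemma deviations_near_of_convergent:
  fixes x :: "nat \<Rightarrow> 'x::finite" and u :: "nat \<Rightarrow> 'u::finite"
  assumes lim: "\<And>i j. filterlim (occurrences (\<lambda>n. x n = i \<and> u n = j)) at_top sequentially \<Longrightarrow>
      (\<lambda>t. mean_deviation R \<gamma> Q x u w t i j) \<longlonglongrightarrow> L i j"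
    and \<delta>: "\<delta> > 0"
  shows "\<exists>k. deviations_near R \<gamma> Q x u w L \<delta> k"
proof -
  define near where "near i j k \<longleftrightarrow> (\<forall>t. k \<le> occurrences (\<lambda>n. x n = i \<and> u n = j) t \<longrightarrow>
    \<bar>mean_deviation R \<gamma> Q x u w t i j - L i j\<bar> \<le> \<delta>)" for i j k
  have "\<exists>k. near i j k" for i j
  proof (cases "\<exists>b. \<forall>t. occurrences (\<lambda>n. x n = i \<and> u n = j) t \<le> b")
    case True
    then obtain b where b: "\<And>t. occurrences (\<lambda>n. x n = i \<and> u n = j) t \<le> b" by blast
    have "near i j (Suc b)"
      unfolding near_def
    proof (intro allI impI)
      fix t assume "Suc b \<le> occurrences (\<lambda>n. x n = i \<and> u n = j) t"
      with b[of t] show "\<bar>mean_deviation R \<gamma> Q x u w t i j - L i j\<bar> \<le> \<delta>" by linarith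
    qed
    then show ?thesis ..
  next
    case False
    let ?p = "\<lambda>n. x n = i \<and> u n = j"
    have "filterlim (occurrences ?p) at_top sequentially"
      unfolding filterlim_at_top eventually_sequentially
    proof
      fix b
      obtain t where t: "\<not> occurrences ?p t \<le> b" using False by blast
      have "b \<le> occurrences ?p n" if "n \<ge> t" for n
        using t monoD[OF mono_occurrences that, of ?p] by linarith
      then show "\<exists>N. \<forall>n\<ge>N. b \<le> occurrences ?p n" by blast
    qed
    from LIMSEQ_D[OF lim[OF this] \<delta>] obtain T
      where T: "\<And>t. t \<ge> T \<Longrightarrow> \<bar>mean_deviation R \<gamma> Q x u w t i j - L i j\<bar> < \<delta>" by auto
    have "t \<ge> T" if "Suc (occurrences ?p T) \<le> occurrences ?p t" for t
      using that monoD[OF mono_occurrences, of t T ?p] by linarith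
    then have "near i j (Suc (occurrences ?p T))"
      unfolding near_def by (blast intro: less_imp_le T)
    then show ?thesis ..
  qed
  then obtain k where k: "\<And>i j. near i j (k i j)" by metis
  define k' where "k' = (\<Sum>i\<in>UNIV. \<Sum>j\<in>UNIV. k i j)"
  have k': "k i j \<le> k'" for i j
    unfolding k'_def using member_le_sum[of j UNIV "k i"] member_le_sum[of i UNIV "\<lambda>i. \<Sum>j\<in>UNIV. k i j"] by simp
  then have "deviations_near R \<gamma> Q x u w L \<delta> k'"
    unfolding deviations_near_def length_visits
  proof (intro allI impI)
    fix i j t assume "k' \<le> occurrences (\<lambda>n. x n = i \<and> u n = j) t"
    then have "k i j \<le> occurrences (\<lambda>n. x n = i \<and> u n = j) t" using k'[of i j] by linarith
    then show "\<bar>mean_deviation R \<gamma> Q x u w t i j - L i j\<bar> \<le> \<delta>" using k[of i j] unfolding near_def by blast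
  qed
  then show ?thesis ..
qed

section \<open>Retained pairs and the decision rule\<close>

lemma sum_occurrences:
  "(\<Sum>i\<in>UNIV. \<Sum>j\<in>UNIV. real (occurrences (\<lambda>n. x n = i \<and> u n = j) t)) = real t"
  for x :: "nat \<Rightarrow> 'x::finite" and u :: "nat \<Rightarrow> 'u::finite"
proof -
  have 1: "(\<Sum>i\<in>UNIV. \<Sum>j\<in>UNIV. of_bool (x m = i \<and> u m = j)) = (1::real)" for m
  proof -
    have "(\<Sum>i\<in>UNIV. \<Sum>j\<in>UNIV. of_bool (x m = i \<and> u m = j)) = (\<Sum>i\<in>{x m}. \<Sum>j\<in>UNIV. of_bool (x m = i \<and> u m = j) :: real)"
      by (rule sum.mono_neutral_right) auto
    also have "\<dots> = (\<Sum>i\<in>{x m}. \<Sum>j\<in>{u m}. of_bool (x m = i \<and> u m = j))"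
      by (intro sum.cong refl sum.mono_neutral_right) auto
    also have "\<dots> = 1" by simp
    finally show ?thesis .
  qed
  have "(\<Sum>i\<in>UNIV. \<Sum>j\<in>UNIV. real (occurrences (\<lambda>n. x n = i \<and> u n = j) t))
      = (\<Sum>m<t. \<Sum>i\<in>UNIV. \<Sum>j\<in>UNIV. of_bool (x m = i \<and> u m = j))"
    unfolding occurrences_eq_sum by (subst sum.swap) (subst sum.swap[where B = "UNIV :: 'x set"], simp)
  then show ?thesis by (simp only: 1) simp
qed

text \<open>The discarding bound is half the average count; if no pair exceeded it, at most
  \<open>t / 2\<close> steps would have been taken.\<close>

lemma retained_pair_exists:
  fixes x :: "nat \<Rightarrow> 'x::finite" and u :: "nat \<Rightarrow> 'u::finite"
  assumes "t > 0"
  shows "\<exists>i j. real (length (visits x u t i j)) > real t / (2 * real CARD('x) * real CARD('u))"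
proof (rule ccontr)
  let ?c = "real t / (2 * real CARD('x) * real CARD('u))"
  assume "\<not> ?thesis"
  then have "real (occurrences (\<lambda>n. x n = i \<and> u n = j) t) \<le> ?c" for i j
    by (simp add: not_less length_visits)
  then have "(\<Sum>i\<in>UNIV. \<Sum>j\<in>UNIV. real (occurrences (\<lambda>n. x n = i \<and> u n = j) t)) \<le> (\<Sum>i\<in>(UNIV::'x set). \<Sum>j\<in>(UNIV::'u set). ?c)"
    by (intro sum_mono)
  also have "\<dots> = real t / 2" by simp
  finally show False using assms by (simp add: sum_occurrences)
qed

text \<open>Positive \<open>t\<close> makes the set under \<open>Max\<close> nonempty, so that the
  maximum has its intended meaning.\<close>

lemma breach_declared_iff:
  fixes x :: "nat \<Rightarrow> 'x::finite" and u :: "nat \<Rightarrow> 'u::finite"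
  assumes "t > 0"
  shows "breach_declared R \<gamma> ebar Q x u w t \<longleftrightarrow>
    (\<exists>i j. real (length (visits x u t i j)) > real t / (2 * real CARD('x) * real CARD('u)) \<and>
      \<bar>mean_deviation R \<gamma> Q x u w t i j\<bar> > (1 + \<gamma>) * ebar)"
proof -
  let ?S = "{\<bar>mean_deviation R \<gamma> Q x u w t i j\<bar> | i j.
    real (length (visits x u t i j)) > real t / (2 * real CARD('x) * real CARD('u))}"
  have "?S \<subseteq> (\<lambda>(i, j). \<bar>mean_deviation R \<gamma> Q x u w t i j\<bar>) ` UNIV" by auto
  then have "finite ?S" by (rule finite_subset) simp
  moreover have "?S \<noteq> {}" using retained_pair_exists[OF assms, of x u] by blast
  ultimately show ?thesis unfolding breach_declared_def by (subst Max_gr_iff) auto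
qed

section \<open>Effect of the estimation error on the limits\<close>

lemma trans_row_inner: "trans_row P i j \<bullet> v = (\<Sum>x\<in>UNIV. pmf (P i j) x * v $ x)"
  by (simp add: trans_row_def inner_vec_def)

lemma abs_trans_row_inner_le:
  assumes "\<And>x. \<bar>v $ x\<bar> \<le> b" shows "\<bar>trans_row P i j \<bullet> v\<bar> \<le> b"
proof -
  have "\<bar>trans_row P i j \<bullet> v\<bar> \<le> (\<Sum>x\<in>UNIV. pmf (P i j) x * \<bar>v $ x\<bar>)"
    unfolding trans_row_inner by (rule order_trans[OF sum_abs]) (simp add: abs_mult)
  also have "\<dots> \<le> (\<Sum>x\<in>UNIV. pmf (P i j) x * b)"
    by (intro sum_mono mult_left_mono assms) simp
  also have "\<dots> = b" by (simp add: sum_distrib_right[symmetric] sum_pmf_eq_1)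
  finally show ?thesis .
qed

text \<open>Taking the maximum over actions is nonexpansive in the supremum norm.\<close>

lemma state_values_diff_le:
  fixes Q Q' :: "'x::finite \<Rightarrow> 'u::finite \<Rightarrow> real"
  assumes "\<And>x u. \<bar>Q x u - Q' x u\<bar> \<le> e"
  shows "\<bar>(state_values Q - state_values Q') $ x\<bar> \<le> e"
proof -
  have "Max (range (f x)) \<le> Max (range (g x)) + e"
    if "\<And>x u. \<bar>f x u - g x u\<bar> \<le> e" for f g :: "'x \<Rightarrow> 'u \<Rightarrow> real" and x
  proof -
    have "f x u \<le> Max (range (g x)) + e" for u
    proof -
      have "g x u \<le> Max (range (g x))" by simp
      then show ?thesis using that[of x u] by linarith
    qed
    then show ?thesis by (subst Max_le_iff) auto
  qed
  from this[of Q Q' x] this[of Q' Q x] assms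
  have "Max (range (Q x)) \<le> Max (range (Q' x)) + e" "Max (range (Q' x)) \<le> Max (range (Q x)) + e"
    by (simp_all add: abs_minus_commute)
  then have "\<bar>Max (range (Q x)) - Max (range (Q' x))\<bar> \<le> e" by linarith
  then show ?thesis by (simp add: state_values_def)
qed

text \<open>The Bellman residual of the estimate itself. It does not mention the optimal Q-function
  and so serves for either kernel.\<close>

definition limit_deviation ::
  "('x::finite \<Rightarrow> 'u::finite \<Rightarrow> 'x pmf) \<Rightarrow> ('x \<Rightarrow> 'u \<Rightarrow> real ^ 'x) \<Rightarrow> real \<Rightarrow> ('x \<Rightarrow> 'u \<Rightarrow> real) \<Rightarrow> 'x \<Rightarrow> 'u \<Rightarrow> real"
  where "limit_deviation P R \<gamma> Q i j = Q i j - trans_row P i j \<bullet> (R i j + \<gamma> *\<^sub>R state_values Q)"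

context
  fixes P :: "'x::finite \<Rightarrow> 'u::finite \<Rightarrow> 'x pmf" and R :: "'x \<Rightarrow> 'u \<Rightarrow> real ^ 'x" and \<gamma> :: real
  assumes \<gamma>: "0 \<le> \<gamma>" "\<gamma> < 1"
begin

text \<open>The Bellman equation cancels the part of the drift weighted by the row of
  \<open>P\<close>; all remaining expectations are taken under \<open>Phat\<close>.\<close>

lemma limit_attack_eq: "limit_attack P Phat R \<gamma> Q = limit_deviation Phat R \<gamma> Q"
proof (intro ext)
  fix i j
  show "limit_attack P Phat R \<gamma> Q i j = limit_deviation Phat R \<gamma> Q i j"
    unfolding limit_attack_def limit_deviation_def value_drift_def bellman_equation[OF \<gamma>, of P R i j]
    by (simp add: inner_add_right inner_diff_right inner_diff_left algebra_simps)
qed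

lemma limit_secure_eq: "limit_secure P R \<gamma> Q = limit_deviation P R \<gamma> Q"
proof (intro ext)
  fix i j
  show "limit_secure P R \<gamma> Q i j = limit_deviation P R \<gamma> Q i j"
    unfolding limit_secure_def limit_deviation_def bellman_equation[OF \<gamma>, of P R i j]
    by (simp add: inner_add_right inner_diff_right algebra_simps)
qed

context
  fixes Q :: "'x \<Rightarrow> 'u \<Rightarrow> real" and e :: real
  assumes acc: "accurate P R \<gamma> e Q"
begin

lemma abs_value_error_le:
  "\<bar>\<gamma> * (trans_row P' i j \<bullet> (v_opt P R \<gamma> - state_values Q))\<bar> \<le> \<gamma> * e"
proof -
  have "\<bar>trans_row P' i j \<bullet> (v_opt P R \<gamma> - state_values Q)\<bar> \<le> e"
    using acc by (intro abs_trans_row_inner_le state_values_diff_le) (simp add: accurate_def abs_minus_commute)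
  then show ?thesis using \<gamma> by (simp add: abs_mult mult_left_mono)
qed

lemma abs_Q_error_le: "\<bar>Q i j - q_opt P R \<gamma> i j\<bar> \<le> e"
  using acc by (simp add: accurate_def)

lemma abs_limit_secure_le: "\<bar>limit_secure P R \<gamma> Q i j\<bar> \<le> (1 + \<gamma>) * e"
  using abs_Q_error_le[of i j] abs_value_error_le[of P i j]
  unfolding limit_secure_def by (simp add: distrib_right)

text \<open>By the reverse triangle inequality the errors can hide at most
  \<open>(1 + \<gamma>) * e\<close> of the drift at any pair.\<close>

lemma abs_limit_attack_ge: "\<bar>limit_attack P Phat R \<gamma> Q i j\<bar> \<ge> min_value_drift P Phat R \<gamma> - (1 + \<gamma>) * e"
proof -
  have "min_value_drift P Phat R \<gamma> \<le> \<bar>value_drift P Phat R \<gamma> i j\<bar>"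
    unfolding min_value_drift_def by (intro Min_le) (auto intro: image_eqI[of _ _ "(i, j)"])
  then show ?thesis
    using abs_Q_error_le[of i j] abs_value_error_le[of Phat i j]
    unfolding limit_attack_def by (simp add: distrib_right)
qed

text \<open>The two limits weight the same value error by different rows, and each row contributes
  at most \<open>\<gamma> * e\<close>.\<close>

lemma abs_limit_attack_approx_diff_le:
  "\<bar>limit_attack P Phat R \<gamma> Q i j - limit_attack_approx P Phat R \<gamma> Q i j\<bar> \<le> 2 * \<gamma> * e"
  using abs_value_error_le[of P i j] abs_value_error_le[of Phat i j]
  unfolding limit_attack_def limit_attack_approx_def limit_secure_def by linarith

context
  fixes x :: "nat \<Rightarrow> 'x" and u :: "nat \<Rightarrow> 'u" and w :: "nat \<Rightarrow> real" and \<delta> ebar :: real and k t :: nat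
  assumes t: "t > 0" and k: "real k \<le> real t / (2 * real CARD('x) * real CARD('u))"
begin

lemma not_breach_declared_of_near:
  assumes near: "deviations_near R \<gamma> Q x u w (limit_secure P R \<gamma> Q) \<delta> k"
    and \<delta>: "(1 + \<gamma>) * e + \<delta> \<le> (1 + \<gamma>) * ebar"
  shows "\<not> breach_declared R \<gamma> ebar Q x u w t"
proof -
  have "\<bar>mean_deviation R \<gamma> Q x u w t i j\<bar> \<le> (1 + \<gamma>) * ebar"
    if "real (length (visits x u t i j)) > real t / (2 * real CARD('x) * real CARD('u))" for i j
  proof -
    have "\<bar>mean_deviation R \<gamma> Q x u w t i j - limit_secure P R \<gamma> Q i j\<bar> \<le> \<delta>"
      using near that k unfolding deviations_near_def by auto
    then show ?thesis using abs_limit_secure_le[of i j] \<delta> by linarith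
  qed
  then show ?thesis unfolding breach_declared_iff[OF t] by (meson not_le)
qed

text \<open>One retained pair is enough, wherever it lies, because the drift is bounded below at all
  pairs.\<close>

lemma breach_declared_of_near:
  assumes near: "deviations_near R \<gamma> Q x u w (limit_attack P Phat R \<gamma> Q) \<delta> k"
    and \<delta>: "(1 + \<gamma>) * ebar + \<delta> < min_value_drift P Phat R \<gamma> - (1 + \<gamma>) * e"
  shows "breach_declared R \<gamma> ebar Q x u w t"
proof -
  obtain i j where ij: "real (length (visits x u t i j)) > real t / (2 * real CARD('x) * real CARD('u))"
    using retained_pair_exists[OF t] by blast
  then have "\<bar>mean_deviation R \<gamma> Q x u w t i j - limit_attack P Phat R \<gamma> Q i j\<bar> \<le> \<delta>"
    using near k unfolding deviations_near_def by auto
  then have "\<bar>mean_deviation R \<gamma> Q x u w t i j\<bar> > (1 + \<gamma>) * ebar"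
    using abs_limit_attack_ge[of Phat i j] \<delta> by linarith
  with ij show ?thesis unfolding breach_declared_iff[OF t] by blast
qed

end

end

end

subsection \<open>Limits of the mean deviations\<close>

context detection_phase
begin

sublocale iid_noise M F W
  by unfold_locales
    (rule sets_F_M W_measurable W_indep W_distr W_integrable W_mean)+

lemma state_measurable: "n \<le> k \<Longrightarrow> (\<lambda>\<omega>. X \<omega> n) \<in> measurable (F k) (count_space UNIV)"
  by (rule measurable_F_mono[OF X_measurable])

lemma action_measurable: "n \<le> k \<Longrightarrow> (\<lambda>\<omega>. U \<omega> n) \<in> measurable (F k) (count_space UNIV)"
  by (rule measurable_F_mono[OF U_measurable])

lemma visit_predictable: "Measurable.pred (F n) (\<lambda>\<omega>. X \<omega> n = i \<and> U \<omega> n = j)"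
  using state_measurable[of n n] action_measurable[of n n] by measurable

lemmas [measurable] = measurable_F[OF X_measurable] measurable_F[OF U_measurable]
  measurable_F[OF W_measurable] measurable_F[OF Q_measurable]

text \<open>The kernel may change with time: the indicators are centred by the kernel in force, and
  the averages of the centring terms over the visits inherit the limit \<open>q\<close>. This is
  where a finite lag disappears.\<close>

lemma transition_frequency_tendsto:
  assumes K: "(\<lambda>n. pmf (K n i j) x') \<longlonglongrightarrow> q"
  shows "AE \<omega> in M. filterlim (occurrences (\<lambda>n. X \<omega> n = i \<and> U \<omega> n = j)) at_top sequentially \<longrightarrow>
    (\<lambda>t. (\<Sum>n<t. of_bool (X \<omega> n = i \<and> U \<omega> n = j) * of_bool (X \<omega> (Suc n) = x'))
      / real (occurrences (\<lambda>n. X \<omega> n = i \<and> U \<omega> n = j) t)) \<longlonglongrightarrow> q"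
proof -
  let ?p = "\<lambda>n \<omega>. X \<omega> n = i \<and> U \<omega> n = j"
  define \<xi> where "\<xi> n \<omega> = of_bool (X \<omega> (Suc n) = x') - pmf (K n i j) x'" for n \<omega>
  have "bounded_mds (\<lambda>n \<omega>. of_bool (?p n \<omega>) * \<xi> n \<omega>)"
    unfolding bounded_mds_def
  proof (intro conjI allI ballI exI)
    show "\<bar>of_bool (?p n \<omega>) * \<xi> n \<omega>\<bar> \<le> 1" for n \<omega>
      using pmf_le_1[of "K n i j" x'] pmf_nonneg[of "K n i j" x'] by (auto simp: \<xi>_def)
    show "(\<lambda>\<omega>. of_bool (?p n \<omega>) * \<xi> n \<omega>) \<in> borel_measurable (F (Suc n))" for n
    proof -
      note [measurable] = state_measurable[of n "Suc n"] action_measurable[of n "Suc n"] state_measurable[of "Suc n" "Suc n"]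
      show ?thesis unfolding \<xi>_def by measurable
    qed
    show "(\<integral>\<omega>. indicator A \<omega> * (of_bool (?p n \<omega>) * \<xi> n \<omega>) \<partial>M) = 0" if A: "A \<in> sets (F n)" for n A
    proof -
      have [measurable]: "A \<in> sets M" using A sets_F by auto
      let ?B = "{\<omega> \<in> A. X \<omega> n = i \<and> U \<omega> n = j \<and> X \<omega> (Suc n) = x'}" and ?C = "{\<omega> \<in> A. X \<omega> n = i \<and> U \<omega> n = j}"
      have "?B = {\<omega> \<in> space M. \<omega> \<in> A \<and> X \<omega> n = i \<and> U \<omega> n = j \<and> X \<omega> (Suc n) = x'}"
        "?C = {\<omega> \<in> space M. \<omega> \<in> A \<and> X \<omega> n = i \<and> U \<omega> n = j}"
        using sets.sets_into_space[OF \<open>A \<in> sets M\<close>] by auto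
      then have BC: "?B \<in> sets M" "?C \<in> sets M" by simp_all
      \<comment> \<open>Written with these two events, mean zero is exactly
        \<open>next_state\<close>.\<close>
      have "indicator A \<omega> * (of_bool (?p n \<omega>) * \<xi> n \<omega>) = indicator ?B \<omega> - pmf (K n i j) x' * indicator ?C \<omega>" for \<omega>
        by (auto simp: \<xi>_def indicator_def)
      then have "(\<integral>\<omega>. indicator A \<omega> * (of_bool (?p n \<omega>) * \<xi> n \<omega>) \<partial>M) = prob ?B - pmf (K n i j) x' * prob ?C"
        using BC sets.sets_into_space[OF BC(1)] sets.sets_into_space[OF BC(2)]
        by (simp add: Int_absorb2 emeasure_eq_measure)
      then show ?thesis using next_state[OF A] by simp
    qed
  qed
  from average_centered_tendsto_0[OF visit_predictable this] show ?thesis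
  proof eventually_elim
    case (elim \<omega>)
    show ?case
    proof
      assume p: "filterlim (occurrences (\<lambda>n. X \<omega> n = i \<and> U \<omega> n = j)) at_top sequentially"
      have split: "of_bool (?p n \<omega>) * of_bool (X \<omega> (Suc n) = x')
          = of_bool (?p n \<omega>) * \<xi> n \<omega> + of_bool (?p n \<omega>) * pmf (K n i j) x'" for n
        by (simp add: \<xi>_def)
      show "(\<lambda>t. (\<Sum>n<t. of_bool (?p n \<omega>) * of_bool (X \<omega> (Suc n) = x'))
          / real (occurrences (\<lambda>n. ?p n \<omega>) t)) \<longlonglongrightarrow> q"
        unfolding split sum.distrib add_divide_distrib
        using tendsto_add[OF elim[rule_format, OF p] average_at_occurrences_tendsto[OF p K]] by simp
    qed
  qed
qed

text \<open>Since there are finitely many states, averages of rewards and values are finite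
  combinations of transition frequencies, with coefficients that are fixed on each path.\<close>

theorem mean_deviation_tendsto:
  assumes K: "\<And>i j x'. (\<lambda>n. pmf (K n i j) x') \<longlonglongrightarrow> pmf (P' i j) x'"
  shows "AE \<omega> in M. \<forall>i j. filterlim (occurrences (\<lambda>n. X \<omega> n = i \<and> U \<omega> n = j)) at_top sequentially \<longrightarrow>
    (\<lambda>t. mean_deviation R \<gamma> (Q \<omega>) (X \<omega>) (U \<omega>) (W \<omega>) t i j) \<longlonglongrightarrow> limit_deviation P' R \<gamma> (Q \<omega>) i j"
proof -
  have "AE \<omega> in M. \<forall>i\<in>UNIV. \<forall>j\<in>UNIV. \<forall>x'\<in>UNIV. filterlim (occurrences (\<lambda>n. X \<omega> n = i \<and> U \<omega> n = j)) at_top sequentially \<longrightarrow>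
    (\<lambda>t. (\<Sum>n<t. of_bool (X \<omega> n = i \<and> U \<omega> n = j) * of_bool (X \<omega> (Suc n) = x'))
      / real (occurrences (\<lambda>n. X \<omega> n = i \<and> U \<omega> n = j) t)) \<longlonglongrightarrow> pmf (P' i j) x'"
    by (intro AE_finite_allI finite transition_frequency_tendsto K)
  moreover have "AE \<omega> in M. \<forall>i\<in>UNIV. \<forall>j\<in>UNIV. filterlim (occurrences (\<lambda>n. X \<omega> n = i \<and> U \<omega> n = j)) at_top sequentially \<longrightarrow>
    (\<lambda>t. (\<Sum>n<t. of_bool (X \<omega> n = i \<and> U \<omega> n = j) * W \<omega> n)
      / real (occurrences (\<lambda>n. X \<omega> n = i \<and> U \<omega> n = j) t)) \<longlonglongrightarrow> 0"
    by (intro AE_finite_allI finite average_noise_tendsto_0 visit_predictable)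
  ultimately show ?thesis
  proof eventually_elim
    case (elim \<omega>)
    show ?case
    proof (intro allI impI)
      fix i j
      let ?p = "\<lambda>n. X \<omega> n = i \<and> U \<omega> n = j"
      let ?N = "\<lambda>t. real (occurrences ?p t)"
      assume p: "filterlim (occurrences ?p) at_top sequentially"
      define g where "g x' = R i j $ x' + \<gamma> * state_values (Q \<omega>) $ x'" for x'
      define freq where "freq x' t = (\<Sum>n<t. of_bool (?p n) * of_bool (X \<omega> (Suc n) = x')) / ?N t" for x' t
      define noise where "noise t = (\<Sum>n<t. of_bool (?p n) * W \<omega> n) / ?N t" for t
      have "(\<lambda>t. Q \<omega> i j - (\<Sum>x'\<in>UNIV. freq x' t * g x') - noise t)
          \<longlonglongrightarrow> Q \<omega> i j - (\<Sum>x'\<in>UNIV. pmf (P' i j) x' * g x') - 0"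
        using elim p unfolding freq_def noise_def by (intro tendsto_intros) auto
      \<comment> \<open>Before the first visit the mean is a division by zero with value 0, so the
        identity is claimed only from the first visit on.\<close>
      moreover have "\<forall>\<^sub>F t in sequentially. Q \<omega> i j - (\<Sum>x'\<in>UNIV. freq x' t * g x') - noise t
          = mean_deviation R \<gamma> (Q \<omega>) (X \<omega>) (U \<omega>) (W \<omega>) t i j"
        using p[unfolded filterlim_at_top, rule_format, of 1]
      proof eventually_elim
        case (elim t)
        have g: "g (X \<omega> (Suc n)) = (\<Sum>x'\<in>UNIV. of_bool (X \<omega> (Suc n) = x') * g x')" for n
          by (simp add: of_bool_def if_distrib[of "\<lambda>c. c * _"] cong: if_cong)
        have "(\<Sum>n<t. of_bool (?p n) * (Q \<omega> i j - R i j $ X \<omega> (Suc n) - W \<omega> n - \<gamma> * state_values (Q \<omega>) $ X \<omega> (Suc n)))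
          = (\<Sum>n<t. of_bool (?p n) * Q \<omega> i j) - (\<Sum>n<t. of_bool (?p n) * g (X \<omega> (Suc n))) - (\<Sum>n<t. of_bool (?p n) * W \<omega> n)"
          unfolding sum_subtractf[symmetric] by (intro sum.cong) (auto simp: g_def algebra_simps)
        also have "(\<Sum>n<t. of_bool (?p n) * Q \<omega> i j) = ?N t * Q \<omega> i j"
          by (simp only: occurrences_eq_sum sum_distrib_right)
        also have "(\<Sum>n<t. of_bool (?p n) * g (X \<omega> (Suc n)))
            = (\<Sum>x'\<in>UNIV. (\<Sum>n<t. of_bool (?p n) * of_bool (X \<omega> (Suc n) = x')) * g x')"
          unfolding g sum_distrib_left sum_distrib_right by (subst sum.swap) (simp only: mult.assoc)
        finally show ?case using elim unfolding mean_deviation_eq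
          by (simp add: diff_divide_distrib sum_divide_distrib freq_def noise_def)
      qed
      ultimately have "(\<lambda>t. mean_deviation R \<gamma> (Q \<omega>) (X \<omega>) (U \<omega>) (W \<omega>) t i j)
          \<longlonglongrightarrow> Q \<omega> i j - (\<Sum>x'\<in>UNIV. pmf (P' i j) x' * g x') - 0"
        by (rule Lim_transform_eventually)
      also have "Q \<omega> i j - (\<Sum>x'\<in>UNIV. pmf (P' i j) x' * g x') - 0 = limit_deviation P' R \<gamma> (Q \<omega>) i j"
        by (simp add: limit_deviation_def trans_row_inner g_def)
      finally show "(\<lambda>t. mean_deviation R \<gamma> (Q \<omega>) (X \<omega>) (U \<omega>) (W \<omega>) t i j) \<longlonglongrightarrow> limit_deviation P' R \<gamma> (Q \<omega>) i j" .
    qed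
  qed
qed

section \<open>Measurability and probability of the events\<close>

lemma state_values_measurable [measurable]: "(\<lambda>\<omega>. state_values (Q \<omega>) $ x) \<in> borel_measurable M"
  unfolding state_values_def by simp

lemma visits_measurable [measurable]: "(\<lambda>\<omega>. length (visits (X \<omega>) (U \<omega>) t i j)) \<in> measurable M (count_space UNIV)"
  unfolding length_visits by measurable

lemma mean_deviation_measurable [measurable]:
  "(\<lambda>\<omega>. mean_deviation R \<gamma> (Q \<omega>) (X \<omega>) (U \<omega>) (W \<omega>) t i j) \<in> borel_measurable M"
proof -
  have [measurable]: "(\<lambda>\<omega>. state_values (Q \<omega>) $ X \<omega> n) \<in> borel_measurable M" for n
    by (rule measurable_compose_countable[of "\<lambda>x \<omega>. state_values (Q \<omega>) $ x"]) measurable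
  have [measurable]: "(\<lambda>\<omega>. R i j $ X \<omega> n) \<in> borel_measurable M" for n
    by (rule measurable_compose[of _ _ "count_space UNIV"]) measurable
  show ?thesis unfolding mean_deviation_eq by measurable
qed

lemma deviations_near_measurable [measurable]:
  assumes [measurable]: "\<And>i j. (\<lambda>\<omega>. L \<omega> i j) \<in> borel_measurable M"
  shows "Measurable.pred M (\<lambda>\<omega>. deviations_near R \<gamma> (Q \<omega>) (X \<omega>) (U \<omega>) (W \<omega>) (L \<omega>) \<delta> k)"
  unfolding deviations_near_def by measurable

lemma breach_declared_measurable:
  assumes "t > 0"
  shows "Measurable.pred M (\<lambda>\<omega>. breach_declared R \<gamma> ebar (Q \<omega>) (X \<omega>) (U \<omega>) (W \<omega>) t)"
  unfolding breach_declared_iff[OF assms] by measurable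

lemma accurate_measurable [measurable]: "Measurable.pred M (\<lambda>\<omega>. accurate P R \<gamma> e (Q \<omega>))"
  unfolding accurate_def by measurable

lemma limit_measurable [measurable]:
  "(\<lambda>\<omega>. limit_deviation P' R \<gamma> (Q \<omega>) i j) \<in> borel_measurable M"
  "(\<lambda>\<omega>. limit_attack_approx P P' R \<gamma> (Q \<omega>) i j) \<in> borel_measurable M"
  unfolding limit_deviation_def limit_attack_approx_def limit_secure_def trans_row_inner by simp_all

text \<open>The events grow with \<open>k\<close>, and by convergence on almost every path their
  union has probability 1.\<close>

theorem prob_deviations_near_tendsto:
  assumes K: "\<And>i j x'. (\<lambda>n. pmf (K n i j) x') \<longlonglongrightarrow> pmf (P' i j) x'" and \<delta>: "\<delta> > 0"
  shows "(\<lambda>k. \<P>(\<omega> in M. deviations_near R \<gamma> (Q \<omega>) (X \<omega>) (U \<omega>) (W \<omega>) (limit_deviation P' R \<gamma> (Q \<omega>)) \<delta> k)) \<longlonglongrightarrow> 1"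
proof -
  define G where "G k = {\<omega> \<in> space M. deviations_near R \<gamma> (Q \<omega>) (X \<omega>) (U \<omega>) (W \<omega>) (limit_deviation P' R \<gamma> (Q \<omega>)) \<delta> k}" for k
  have G[measurable]: "G k \<in> sets M" for k unfolding G_def by measurable
  have "incseq G" unfolding incseq_def G_def by (auto intro: deviations_near_mono)
  then have "(\<lambda>k. prob (G k)) \<longlonglongrightarrow> prob (\<Union>k. G k)" by (intro finite_Lim_measure_incseq) auto
  moreover have "AE \<omega> in M. \<omega> \<in> (\<Union>k. G k)"
    using mean_deviation_tendsto[OF K, of R \<gamma>] AE_space
  proof eventually_elim
    case (elim \<omega>)
    have "\<exists>k. deviations_near R \<gamma> (Q \<omega>) (X \<omega>) (U \<omega>) (W \<omega>) (limit_deviation P' R \<gamma> (Q \<omega>)) \<delta> k"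
      by (rule deviations_near_of_convergent[OF elim(1)[rule_format] \<delta>])
    then show ?case using elim(2) by (simp add: G_def)
  qed
  then have "prob (\<Union>k. G k) = 1" by (subst prob_eq_1) auto
  ultimately show ?thesis unfolding G_def by simp
qed

end

subsection \<open>False alarms and missed detections\<close>

text \<open>Common frame for false alarms, missed detections and the approximate limit: under an
  accurate estimate the exception \<open>B t\<close> can occur only where the deviations are not yet
  near their limits. The function \<open>\<theta>\<close> converts the running parameter into a
  number of visits.\<close>

lemma (in detection_phase) prob_accurate_exception_tendsto_0:
  assumes K: "\<And>i j x'. (\<lambda>n. pmf (K n i j) x') \<longlonglongrightarrow> pmf (P' i j) x'" and \<delta>: "\<delta> > 0"
    and \<theta>: "filterlim \<theta> at_top sequentially"
    and B: "\<forall>\<^sub>F t in sequentially. \<forall>\<omega>. accurate P R \<gamma> e (Q \<omega>) \<longrightarrow>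
      deviations_near R \<gamma> (Q \<omega>) (X \<omega>) (U \<omega>) (W \<omega>) (limit_deviation P' R \<gamma> (Q \<omega>)) \<delta> (\<theta> t) \<longrightarrow> \<not> B t \<omega>"
  shows "(\<lambda>t. \<P>(\<omega> in M. accurate P R \<gamma> e (Q \<omega>) \<and> B t \<omega>)) \<longlonglongrightarrow> 0"
proof -
  let ?G = "\<lambda>k. {\<omega> \<in> space M. deviations_near R \<gamma> (Q \<omega>) (X \<omega>) (U \<omega>) (W \<omega>) (limit_deviation P' R \<gamma> (Q \<omega>)) \<delta> k}"
  have "(\<lambda>t. 1 - prob (?G (\<theta> t))) \<longlonglongrightarrow> 1 - 1"
    by (intro tendsto_intros filterlim_compose[OF prob_deviations_near_tendsto[OF K \<delta>] \<theta>])
  then have lim: "(\<lambda>t. 1 - prob (?G (\<theta> t))) \<longlonglongrightarrow> 0" by simp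
  show ?thesis
  proof (rule tendsto_sandwich[OF _ _ tendsto_const lim])
    show "\<forall>\<^sub>F t in sequentially. \<P>(\<omega> in M. accurate P R \<gamma> e (Q \<omega>) \<and> B t \<omega>) \<le> 1 - prob (?G (\<theta> t))"
      using B
    proof eventually_elim
      case (elim t)
      have G: "?G (\<theta> t) \<in> sets M" by measurable
      have "\<P>(\<omega> in M. accurate P R \<gamma> e (Q \<omega>) \<and> B t \<omega>) \<le> prob (space M - ?G (\<theta> t))"
        using elim G by (intro finite_measure_mono) auto
      then show ?case using prob_compl[OF G] by simp
    qed
  qed simp
qed

text \<open>With \<open>c\<close> the number of state-action pairs, every retained pair has at least
  this many visits.\<close>

definition visit_threshold :: "nat \<Rightarrow> nat \<Rightarrow> nat" where
  "visit_threshold c t = nat \<lfloor>real t / (2 * real c)\<rfloor>"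

lemma visit_threshold_le: "real (visit_threshold c t) \<le> real t / (2 * real c)"
  by (simp add: visit_threshold_def)

lemma visit_threshold_at_top: "c > 0 \<Longrightarrow> filterlim (visit_threshold c) at_top sequentially"
  unfolding visit_threshold_def[abs_def]
  by (intro filterlim_compose[OF filterlim_nat_sequentially] filterlim_compose[OF filterlim_floor_sequentially])
    real_asymp

context detection_phase
begin

lemma prob_false_alarm_tendsto_0:
  assumes \<gamma>: "0 \<le> \<gamma>" "\<gamma> < 1"
    and K: "\<And>i j x'. (\<lambda>n. pmf (K n i j) x') \<longlonglongrightarrow> pmf (P i j) x'" and e: "e < ebar"
  shows "(\<lambda>t. \<P>(\<omega> in M. accurate P R \<gamma> e (Q \<omega>) \<and>
    breach_declared R \<gamma> ebar (Q \<omega>) (X \<omega>) (U \<omega>) (W \<omega>) t)) \<longlonglongrightarrow> 0"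
proof (rule prob_accurate_exception_tendsto_0[OF K])
  \<comment> \<open>The tolerance is the whole gap between the bound on the secure limits and the
    threshold; it is positive because \<open>e < ebar\<close> is strict.\<close>
  show "(1 + \<gamma>) * (ebar - e) > 0" using \<gamma> e by simp
  show "filterlim (visit_threshold (CARD('x) * CARD('u))) at_top sequentially"
    by (rule visit_threshold_at_top) simp
  show "\<forall>\<^sub>F t in sequentially. \<forall>\<omega>. accurate P R \<gamma> e (Q \<omega>) \<longrightarrow>
      deviations_near R \<gamma> (Q \<omega>) (X \<omega>) (U \<omega>) (W \<omega>) (limit_deviation P R \<gamma> (Q \<omega>))
        ((1 + \<gamma>) * (ebar - e)) (visit_threshold (CARD('x) * CARD('u)) t) \<longrightarrow>
      \<not> breach_declared R \<gamma> ebar (Q \<omega>) (X \<omega>) (U \<omega>) (W \<omega>) t"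
    using eventually_gt_at_top[of 0]
  proof eventually_elim
    case (elim t)
    show ?case
    proof (intro allI impI)
      fix \<omega>
      assume "accurate P R \<gamma> e (Q \<omega>)"
        "deviations_near R \<gamma> (Q \<omega>) (X \<omega>) (U \<omega>) (W \<omega>) (limit_deviation P R \<gamma> (Q \<omega>))
          ((1 + \<gamma>) * (ebar - e)) (visit_threshold (CARD('x) * CARD('u)) t)"
      then show "\<not> breach_declared R \<gamma> ebar (Q \<omega>) (X \<omega>) (U \<omega>) (W \<omega>) t"
        using visit_threshold_le[of "CARD('x) * CARD('u)" t]
        by (intro not_breach_declared_of_near[OF \<gamma> _ elim, of P R e _ _ _ _ _ "(1 + \<gamma>) * (ebar - e)"])
          (simp_all add: limit_secure_eq[OF \<gamma>] mult.assoc right_diff_distrib)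
    qed
  qed
qed

lemma prob_missed_detection_tendsto_0:
  assumes \<gamma>: "0 \<le> \<gamma>" "\<gamma> < 1"
    and K: "\<And>i j x'. (\<lambda>n. pmf (K n i j) x') \<longlonglongrightarrow> pmf (Phat i j) x'" and e: "e \<le> ebar"
    and adv: "min_value_drift P Phat R \<gamma> > 2 * (1 + \<gamma>) * ebar"
  shows "(\<lambda>t. \<P>(\<omega> in M. accurate P R \<gamma> e (Q \<omega>) \<and>
    \<not> breach_declared R \<gamma> ebar (Q \<omega>) (X \<omega>) (U \<omega>) (W \<omega>) t)) \<longlonglongrightarrow> 0"
proof (rule prob_accurate_exception_tendsto_0[OF K])
  \<comment> \<open>Half of the margin: threshold plus tolerance is then
    \<open>min_value_drift P Phat R \<gamma> / 2\<close>, strictly below the bound on the limits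
    under attack.\<close>
  define \<delta> where "\<delta> = (min_value_drift P Phat R \<gamma> - 2 * (1 + \<gamma>) * ebar) / 2"
  show \<delta>: "\<delta> > 0" using adv unfolding \<delta>_def by simp
  have "(1 + \<gamma>) * e \<le> (1 + \<gamma>) * ebar" using \<gamma> e by simp
  moreover have "b + (m - 2 * b) / 2 < m - a" if "a \<le> b" "2 * b < m" for a b m :: real
    using that by (simp add: diff_divide_distrib)
  ultimately have gap: "(1 + \<gamma>) * ebar + \<delta> < min_value_drift P Phat R \<gamma> - (1 + \<gamma>) * e"
    using adv unfolding \<delta>_def mult.assoc[of 2 "1 + \<gamma>" ebar] by blast
  show "filterlim (visit_threshold (CARD('x) * CARD('u))) at_top sequentially"
    by (rule visit_threshold_at_top) simp
  show "\<forall>\<^sub>F t in sequentially. \<forall>\<omega>. accurate P R \<gamma> e (Q \<omega>) \<longrightarrow>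
      deviations_near R \<gamma> (Q \<omega>) (X \<omega>) (U \<omega>) (W \<omega>) (limit_deviation Phat R \<gamma> (Q \<omega>))
        \<delta> (visit_threshold (CARD('x) * CARD('u)) t) \<longrightarrow>
      \<not> \<not> breach_declared R \<gamma> ebar (Q \<omega>) (X \<omega>) (U \<omega>) (W \<omega>) t"
    using eventually_gt_at_top[of 0]
  proof eventually_elim
    case (elim t)
    show ?case
    proof (intro allI impI, unfold not_not)
      fix \<omega>
      assume "accurate P R \<gamma> e (Q \<omega>)"
        "deviations_near R \<gamma> (Q \<omega>) (X \<omega>) (U \<omega>) (W \<omega>) (limit_deviation Phat R \<gamma> (Q \<omega>))
          \<delta> (visit_threshold (CARD('x) * CARD('u)) t)"
      then show "breach_declared R \<gamma> ebar (Q \<omega>) (X \<omega>) (U \<omega>) (W \<omega>) t"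
        using visit_threshold_le[of "CARD('x) * CARD('u)" t]
        by (intro breach_declared_of_near[OF \<gamma> _ elim _ _ gap])
          (simp_all add: limit_attack_eq[OF \<gamma>] mult.assoc)
    qed
  qed
qed

lemma prob_approx_exception_tendsto_0:
  assumes \<gamma>: "0 \<le> \<gamma>" "\<gamma> < 1"
    and K: "\<And>i j x'. (\<lambda>n. pmf (K n i j) x') \<longlonglongrightarrow> pmf (Phat i j) x'" and e: "2 * \<gamma> * e < \<delta>"
  shows "(\<lambda>k. \<P>(\<omega> in M. accurate P R \<gamma> e (Q \<omega>) \<and>
    \<not> deviations_near R \<gamma> (Q \<omega>) (X \<omega>) (U \<omega>) (W \<omega>) (limit_attack_approx P Phat R \<gamma> (Q \<omega>)) \<delta> k)) \<longlonglongrightarrow> 0"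
proof (rule prob_accurate_exception_tendsto_0[OF K])
  \<comment> \<open>The rest of the tolerance is reserved for the passage from
    \<open>limit_attack\<close> to \<open>limit_attack_approx\<close>.\<close>
  show "\<delta> - 2 * \<gamma> * e > 0" using e by simp
  show "filterlim (\<lambda>k. k) at_top (sequentially :: nat filter)" by (rule filterlim_ident)
  have "deviations_near R \<gamma> (Q \<omega>) (X \<omega>) (U \<omega>) (W \<omega>) (limit_attack_approx P Phat R \<gamma> (Q \<omega>)) \<delta> k"
    if acc: "accurate P R \<gamma> e (Q \<omega>)"
      and near: "deviations_near R \<gamma> (Q \<omega>) (X \<omega>) (U \<omega>) (W \<omega>) (limit_deviation Phat R \<gamma> (Q \<omega>)) (\<delta> - 2 * \<gamma> * e) k" for \<omega> k
    unfolding deviations_near_def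
  proof (intro allI impI)
    fix i j t assume "k \<le> length (visits (X \<omega>) (U \<omega>) t i j)"
    then have "\<bar>mean_deviation R \<gamma> (Q \<omega>) (X \<omega>) (U \<omega>) (W \<omega>) t i j - limit_attack P Phat R \<gamma> (Q \<omega>) i j\<bar> \<le> \<delta> - 2 * \<gamma> * e"
      using near unfolding deviations_near_def limit_attack_eq[OF \<gamma>] by blast
    then show "\<bar>mean_deviation R \<gamma> (Q \<omega>) (X \<omega>) (U \<omega>) (W \<omega>) t i j - limit_attack_approx P Phat R \<gamma> (Q \<omega>) i j\<bar> \<le> \<delta>"
      using abs_limit_attack_approx_diff_le[OF \<gamma> acc, of Phat i j] by linarith
  qed
  then show "\<forall>\<^sub>F k in sequentially. \<forall>\<omega>. accurate P R \<gamma> e (Q \<omega>) \<longrightarrow>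
      deviations_near R \<gamma> (Q \<omega>) (X \<omega>) (U \<omega>) (W \<omega>) (limit_deviation Phat R \<gamma> (Q \<omega>)) (\<delta> - 2 * \<gamma> * e) k \<longrightarrow>
      \<not> \<not> deviations_near R \<gamma> (Q \<omega>) (X \<omega>) (U \<omega>) (W \<omega>) (limit_attack_approx P Phat R \<gamma> (Q \<omega>)) \<delta> k"
    by (intro always_eventually) blast
qed

end

text \<open>Half of \<open>\<eta>\<close> is spent on an inaccurate estimate, uniformly in
  \<open>n\<close>; the other half, once a long training is fixed, on the exception under an
  accurate one.\<close>

lemma whp_after_trainingI:
  assumes M: "\<And>ta. prob_space (M ta)"
    and A: "\<And>ta. Measurable.pred (M ta) (A ta)" "(\<lambda>ta. \<P>(\<omega> in M ta. A ta \<omega>)) \<longlonglongrightarrow> 1"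
    and C: "\<And>ta n. n > 0 \<Longrightarrow> Measurable.pred (M ta) (C ta n)"
    and exc: "\<forall>\<^sub>F ta in sequentially. (\<lambda>n. \<P>(\<omega> in M ta. A ta \<omega> \<and> \<not> C ta n \<omega>)) \<longlonglongrightarrow> 0"
  shows "whp_after_training (\<lambda>ta n. \<P>(\<omega> in M ta. C ta n \<omega>))"
  unfolding whp_after_training_def
proof (intro allI impI)
  fix \<eta> :: real assume \<eta>: "\<eta> > 0"
  have "\<forall>\<^sub>F ta in sequentially. \<P>(\<omega> in M ta. A ta \<omega>) > 1 - \<eta> / 2"
    using A(2) \<eta> by (intro order_tendstoD(1)) auto
  with exc show "\<forall>\<^sub>F ta in sequentially. \<forall>\<^sub>F n in sequentially. \<P>(\<omega> in M ta. C ta n \<omega>) \<ge> 1 - \<eta>"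
  proof eventually_elim
    case (elim ta)
    interpret prob_space "M ta" by (rule M)
    have "\<forall>\<^sub>F n in sequentially. \<P>(\<omega> in M ta. A ta \<omega> \<and> \<not> C ta n \<omega>) < \<eta> / 2"
      using elim(1) \<eta> by (intro order_tendstoD(2)) auto
    then show ?case using eventually_gt_at_top[of 0]
    proof eventually_elim
      case (elim n)
      note [measurable] = A(1)[of ta] C[OF elim(2), of ta]
      have "\<P>(\<omega> in M ta. A ta \<omega>) \<le> prob ({\<omega> \<in> space (M ta). C ta n \<omega>} \<union> {\<omega> \<in> space (M ta). A ta \<omega> \<and> \<not> C ta n \<omega>})"
        by (intro finite_measure_mono) auto
      also have "\<dots> \<le> \<P>(\<omega> in M ta. C ta n \<omega>) + \<P>(\<omega> in M ta. A ta \<omega> \<and> \<not> C ta n \<omega>)"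
        by (intro measure_Un_le) auto
      finally show ?case using elim(1) \<open>1 - \<eta> / 2 < _\<close> by linarith
    qed
  qed
qed

text \<open>For a fixed training length, error probabilities of the decision are claimed jointly
  with accuracy of the estimate; the statements over both regimes then absorb the probability of an
  inaccurate one.\<close>

theorem theorem8:
  fixes P Phat :: "'x::finite \<Rightarrow> 'u::finite \<Rightarrow> 'x pmf"
    and R :: "'x \<Rightarrow> 'u \<Rightarrow> real ^ 'x"
    and \<gamma> ebar :: real and e :: "nat \<Rightarrow> real"
    and M :: "nat \<Rightarrow> 'w measure" and F :: "nat \<Rightarrow> nat \<Rightarrow> 'w measure"
    and K :: "nat \<Rightarrow> 'x \<Rightarrow> 'u \<Rightarrow> 'x pmf"
    and Q :: "nat \<Rightarrow> 'w \<Rightarrow> 'x \<Rightarrow> 'u \<Rightarrow> real"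
    and X :: "nat \<Rightarrow> 'w \<Rightarrow> nat \<Rightarrow> 'x" and U :: "nat \<Rightarrow> 'w \<Rightarrow> nat \<Rightarrow> 'u"
    and W :: "nat \<Rightarrow> 'w \<Rightarrow> nat \<Rightarrow> real"
  assumes discount: "0 \<le> \<gamma>" "\<gamma> < 1"
    and detection: "\<And>ta. detection_phase (M ta) (F ta) K (Q ta) (X ta) (U ta) (W ta)"
    and training: "(\<lambda>ta. \<P>(\<omega> in M ta. accurate P R \<gamma> (e ta) (Q ta \<omega>)))
      \<longlonglongrightarrow> 1"
    and error: "e \<longlonglongrightarrow> 0" "\<And>ta. e ta \<le> ebar"
  shows
    "(K = secure P \<longrightarrow>
       (\<forall>ta. \<forall>\<delta>>0. (\<lambda>k. \<P>(\<omega> in M ta.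
          deviations_near R \<gamma> (Q ta \<omega>) (X ta \<omega>) (U ta \<omega>) (W ta \<omega>)
            (limit_secure P R \<gamma> (Q ta \<omega>)) \<delta> k)) \<longlonglongrightarrow> 1) \<and>
       (min_value_drift P Phat R \<gamma> > 2 * (1 + \<gamma>) * ebar \<longrightarrow>
         (\<forall>ta. e ta < ebar \<longrightarrow> (\<lambda>t. \<P>(\<omega> in M ta.
            accurate P R \<gamma> (e ta) (Q ta \<omega>) \<and>
            breach_declared R \<gamma> ebar (Q ta \<omega>) (X ta \<omega>) (U ta \<omega>) (W ta \<omega>) t)) \<longlonglongrightarrow> 0) \<and>
         (0 < ebar \<longrightarrow> whp_after_training (\<lambda>ta t. \<P>(\<omega> in M ta.
            \<not> breach_declared R \<gamma> ebar (Q ta \<omega>) (X ta \<omega>) (U ta \<omega>) (W ta \<omega>) t))))) \<and>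
     (\<forall>tL. K = attack_after tL P Phat \<longrightarrow>
       (\<forall>ta. \<forall>\<delta>>0. (\<lambda>k. \<P>(\<omega> in M ta.
          deviations_near R \<gamma> (Q ta \<omega>) (X ta \<omega>) (U ta \<omega>) (W ta \<omega>)
            (limit_attack P Phat R \<gamma> (Q ta \<omega>)) \<delta> k)) \<longlonglongrightarrow> 1) \<and>
       (\<forall>\<delta>>0. whp_after_training (\<lambda>ta k. \<P>(\<omega> in M ta.
          deviations_near R \<gamma> (Q ta \<omega>) (X ta \<omega>) (U ta \<omega>) (W ta \<omega>)
            (limit_attack_approx P Phat R \<gamma> (Q ta \<omega>)) \<delta> k))) \<and>
       (min_value_drift P Phat R \<gamma> > 2 * (1 + \<gamma>) * ebar \<longrightarrow>
         (\<forall>ta. (\<lambda>t. \<P>(\<omega> in M ta.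
            accurate P R \<gamma> (e ta) (Q ta \<omega>) \<and>
            \<not> breach_declared R \<gamma> ebar (Q ta \<omega>) (X ta \<omega>) (U ta \<omega>) (W ta \<omega>) t)) \<longlonglongrightarrow> 0) \<and>
         whp_after_training (\<lambda>ta t. \<P>(\<omega> in M ta.
            breach_declared R \<gamma> ebar (Q ta \<omega>) (X ta \<omega>) (U ta \<omega>) (W ta \<omega>) t))))"
proof (intro conjI impI allI)
  have prob: "prob_space (M ta)" for ta
    using detection[of ta] by (rule detection_phase.axioms)
  have acc: "Measurable.pred (M ta) (\<lambda>\<omega>. accurate P R \<gamma> (e ta) (Q ta \<omega>))" for ta
    by (rule detection_phase.accurate_measurable[OF detection])
  have breach: "Measurable.pred (M ta) (\<lambda>\<omega>. breach_declared R \<gamma> ebar (Q ta \<omega>) (X ta \<omega>) (U ta \<omega>) (W ta \<omega>) t)"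
    if "t > 0" for ta t
    by (rule detection_phase.breach_declared_measurable[OF detection that])
  note whp = whp_after_trainingI[of M "\<lambda>ta \<omega>. accurate P R \<gamma> (e ta) (Q ta \<omega>)", OF prob acc training]
  {
    assume "K = secure P"
    then have K: "(\<lambda>n. pmf (K n i j) x') \<longlonglongrightarrow> pmf (P i j) x'" for i j x'
      by (simp add: secure_def)
    show "(\<lambda>k. \<P>(\<omega> in M ta. deviations_near R \<gamma> (Q ta \<omega>) (X ta \<omega>) (U ta \<omega>) (W ta \<omega>)
        (limit_secure P R \<gamma> (Q ta \<omega>)) \<delta> k)) \<longlonglongrightarrow> 1" if "\<delta> > 0" for ta \<delta>
      using detection_phase.prob_deviations_near_tendsto[OF detection K that, of ta R \<gamma>]
      by (simp add: limit_secure_eq[OF discount])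
    show false_alarm: "(\<lambda>t. \<P>(\<omega> in M ta. accurate P R \<gamma> (e ta) (Q ta \<omega>) \<and>
        breach_declared R \<gamma> ebar (Q ta \<omega>) (X ta \<omega>) (U ta \<omega>) (W ta \<omega>) t)) \<longlonglongrightarrow> 0" if "e ta < ebar" for ta
      by (rule detection_phase.prob_false_alarm_tendsto_0[OF detection discount K that])
    assume "0 < ebar"
    \<comment> \<open>The vanishing training error supplies the strict inequality for all long
      trainings, even if \<open>e ta = ebar\<close> occurs at first.\<close>
    then have "\<forall>\<^sub>F ta in sequentially. e ta < ebar" by (rule order_tendstoD(2)[OF error(1)])
    then show "whp_after_training (\<lambda>ta t. \<P>(\<omega> in M ta.
        \<not> breach_declared R \<gamma> ebar (Q ta \<omega>) (X ta \<omega>) (U ta \<omega>) (W ta \<omega>) t))"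
      by (intro whp pred_intros_logic breach) (auto elim!: eventually_mono dest: false_alarm)
  }
  fix tL assume KL: "K = attack_after tL P Phat"
  \<comment> \<open>The kernel is constantly \<open>Phat\<close> from step \<open>tL\<close> on,
    which is all that the limit theorems see of the lag.\<close>
  have K: "(\<lambda>n. pmf (K n i j) x') \<longlonglongrightarrow> pmf (Phat i j) x'" for i j x'
    by (intro tendsto_eventually eventually_sequentiallyI[of tL]) (simp add: KL attack_after_def)
  show "(\<lambda>k. \<P>(\<omega> in M ta. deviations_near R \<gamma> (Q ta \<omega>) (X ta \<omega>) (U ta \<omega>) (W ta \<omega>)
      (limit_attack P Phat R \<gamma> (Q ta \<omega>)) \<delta> k)) \<longlonglongrightarrow> 1" if "\<delta> > 0" for ta \<delta>
    using detection_phase.prob_deviations_near_tendsto[OF detection K that, of ta R \<gamma>]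
    by (simp add: limit_attack_eq[OF discount])
  show "whp_after_training (\<lambda>ta k. \<P>(\<omega> in M ta.
      deviations_near R \<gamma> (Q ta \<omega>) (X ta \<omega>) (U ta \<omega>) (W ta \<omega>)
        (limit_attack_approx P Phat R \<gamma> (Q ta \<omega>)) \<delta> k))" if "\<delta> > 0" for \<delta>
  proof (rule whp)
    have "(\<lambda>ta. 2 * \<gamma> * e ta) \<longlonglongrightarrow> 2 * \<gamma> * 0" by (intro tendsto_intros error(1))
    then have "\<forall>\<^sub>F ta in sequentially. 2 * \<gamma> * e ta < \<delta>" using that by (intro order_tendstoD(2)) auto
    then show "\<forall>\<^sub>F ta in sequentially. (\<lambda>k. \<P>(\<omega> in M ta. accurate P R \<gamma> (e ta) (Q ta \<omega>) \<and>
        \<not> deviations_near R \<gamma> (Q ta \<omega>) (X ta \<omega>) (U ta \<omega>) (W ta \<omega>)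
          (limit_attack_approx P Phat R \<gamma> (Q ta \<omega>)) \<delta> k)) \<longlonglongrightarrow> 0"
      by eventually_elim (rule detection_phase.prob_approx_exception_tendsto_0[OF detection discount K])
  qed (intro detection_phase.deviations_near_measurable[OF detection] detection_phase.limit_measurable[OF detection])
  assume adv: "min_value_drift P Phat R \<gamma> > 2 * (1 + \<gamma>) * ebar"
  show missed: "(\<lambda>t. \<P>(\<omega> in M ta. accurate P R \<gamma> (e ta) (Q ta \<omega>) \<and>
      \<not> breach_declared R \<gamma> ebar (Q ta \<omega>) (X ta \<omega>) (U ta \<omega>) (W ta \<omega>) t)) \<longlonglongrightarrow> 0" for ta
    by (rule detection_phase.prob_missed_detection_tendsto_0[OF detection discount K error(2) adv])
  show "whp_after_training (\<lambda>ta t. \<P>(\<omega> in M ta.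
      breach_declared R \<gamma> ebar (Q ta \<omega>) (X ta \<omega>) (U ta \<omega>) (W ta \<omega>) t))"
    by (intro whp breach always_eventually allI missed)
qed

end
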